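(* Let $d\ge 2$, let $B^d\subset\mathbb{E}^d$ be the closed unit ball centered at the origin, and let $0<W<2$. Suppose that a finite family of planks $P_1,\ldots,P_n$ in $\mathbb{E}^d$ with $\sum_{i=1}^n w(P_i)=W$ is optimal, i.e. it maximizes $\mathrm{vol}_d\bigl(B^d\cap\bigcup_i P_i\bigr)$ among all finite families of planks of total width $W$. Then, up to boundaries, the union of the planks is a single central plank of width $W$: there is a unit vector $u\in S^{d-1}$ such that the symmetric difference of $\bigcup_{i=1}^n P_i$ and $\{x\in\mathbb{E}^d : |\langle x,u\rangle|\le W/2\}$ is contained in the union of the hyperplanes bounding $P_1,\ldots,P_n$ and the two hyperplanes $\{x : \langle x,u\rangle=\pm W/2\}$.
   Context: $\mathbb{E}^d$ is $d$-dimensional Euclidean space with inner product $\langle\cdot,\cdot\rangle$ and norm $|\cdot|$; $S^{d-1}$ is its unit sphere and $\mathrm{vol}_d$ is Lebesgue measure. A plank of width $w>0$ is the closed (or open) set of points lying between two parallel hyperplanes at distance $w$ from each other; $w(P)$ denotes the width of the plank $P$. The planks in a family may have different directions. *)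

theory Defs
  imports "HOL-Analysis.Analysis"
begin

definition hyperplane :: "'a::euclidean_space \<Rightarrow> real \<Rightarrow> 'a set" where
  "hyperplane u a = {x. x \<bullet> u = a}"

definition closed_strip :: "'a::euclidean_space \<Rightarrow> real \<Rightarrow> real \<Rightarrow> 'a set" where
  "closed_strip u a b = {x. a \<le> x \<bullet> u \<and> x \<bullet> u \<le> b}"

definition open_strip :: "'a::euclidean_space \<Rightarrow> real \<Rightarrow> real \<Rightarrow> 'a set" where
  "open_strip u a b = {x. a < x \<bullet> u \<and> x \<bullet> u < b}"

text \<open>Since \<^term>\<open>u\<close> is a unit vector, the hyperplanes \<^term>\<open>hyperplane u a\<close> and
  \<^term>\<open>hyperplane u b\<close> are at distance \<^term>\<open>b - a\<close>. A plank is a set, either closed or open;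
  a family may contain planks of both kinds.\<close>

definition plank_of_width :: "real \<Rightarrow> 'a::euclidean_space set \<Rightarrow> bool" where
  "plank_of_width w P \<longleftrightarrow>
     (\<exists>u a b. norm u = 1 \<and> a < b \<and> w = b - a \<and> (P = closed_strip u a b \<or> P = open_strip u a b))"

definition plank :: "'a::euclidean_space set \<Rightarrow> bool" where
  "plank P \<longleftrightarrow> (\<exists>w. plank_of_width w P)"

definition width :: "'a::euclidean_space set \<Rightarrow> real" where
  "width P = (THE w. plank_of_width w P)"

text \<open>Families \<^term>\<open>P 1\<close>, ..., \<^term>\<open>P n\<close> are indexed, so a plank may be repeated.\<close>

definition plank_family :: "real \<Rightarrow> nat \<Rightarrow> (nat \<Rightarrow> 'a::euclidean_space set) \<Rightarrow> bool" where
  "plank_family W n P \<longleftrightarrow> (\<forall>i\<in>{1..n}. plank (P i)) \<and> (\<Sum>i=1..n. width (P i)) = W"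

definition covered_volume :: "nat \<Rightarrow> (nat \<Rightarrow> 'a::euclidean_space set) \<Rightarrow> real" where
  "covered_volume n P = measure lebesgue (cball 0 1 \<inter> (\<Union>i\<in>{1..n}. P i))"

definition optimal_plank_family :: "real \<Rightarrow> nat \<Rightarrow> (nat \<Rightarrow> 'a::euclidean_space set) \<Rightarrow> bool" where
  "optimal_plank_family W n P \<longleftrightarrow>
     plank_family W n P \<and>
     (\<forall>m (Q :: nat \<Rightarrow> 'a set). plank_family W m Q \<longrightarrow> covered_volume m Q \<le> covered_volume n P)"

text \<open>The width is well defined, and the union of the two hyperplanes bounding a plank is its
  topological boundary.\<close>

lemma strip_width_mono:
  fixes u v :: "'a::euclidean_space"
  assumes u: "norm u = 1" and v: "norm v = 1" and ab: "a < b"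
    and sub: "open_strip u a b \<subseteq> closed_strip v c d"
  shows "b - a \<le> d - c"
proof -
  define x where "x = ((a + b) / 2) *\<^sub>R u"
  have uu: "u \<bullet> u = 1" and vv: "v \<bullet> v = 1"
    using u v by (simp_all add: dot_square_norm)
  have vu: "\<bar>v \<bullet> u\<bar> \<le> 1"
    using Cauchy_Schwarz_ineq2[of v u] u v by simp
  have main: "2 * e \<le> d - c" if e: "0 < e" "e < (b - a) / 2" for e
  proof -
    have "\<bar>e * (v \<bullet> u)\<bar> \<le> e"
      using mult_left_mono[OF vu, of e] e by (simp add: abs_mult)
    then have "e * (v \<bullet> u) \<le> e" "- e \<le> e * (v \<bullet> u)"
      by (auto simp: abs_le_iff)
    moreover have "(x + e *\<^sub>R v) \<bullet> u = (a + b) / 2 + e * (v \<bullet> u)"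
      "(x - e *\<^sub>R v) \<bullet> u = (a + b) / 2 - e * (v \<bullet> u)"
      by (simp_all add: x_def inner_simps uu)
    ultimately have "x + e *\<^sub>R v \<in> open_strip u a b" "x - e *\<^sub>R v \<in> open_strip u a b"
      using e unfolding open_strip_def mem_Collect_eq by argo+
    then have "x + e *\<^sub>R v \<in> closed_strip v c d" "x - e *\<^sub>R v \<in> closed_strip v c d"
      using sub by auto
    then show ?thesis
      by (auto simp: closed_strip_def inner_simps vv)
  qed
  show ?thesis
  proof (rule ccontr)
    assume neg: "\<not> b - a \<le> d - c"
    define e where "e = (max 0 ((d - c) / 2) + (b - a) / 2) / 2"
    have "0 < e" "e < (b - a) / 2" "d - c < 2 * e"
      using neg ab by (auto simp: e_def max_def field_simps)
    then show False using main by force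
  qed
qed

lemma open_strip_subset: "open_strip u a b \<subseteq> closed_strip u a b"
  by (auto simp: open_strip_def closed_strip_def)

lemma plank_of_width_unique:
  assumes "plank_of_width w P" "plank_of_width w' P"
  shows "w = w'"
proof -
  have "w \<le> w'" if "plank_of_width w P" "plank_of_width w' P" for w w'
  proof -
    from that obtain u a b v c d where
      u: "norm u = 1" "a < b" "w = b - a" "P = closed_strip u a b \<or> P = open_strip u a b"
      and v: "norm v = 1" "w' = d - c" "P = closed_strip v c d \<or> P = open_strip v c d"
      unfolding plank_of_width_def by blast
    have "open_strip u a b \<subseteq> closed_strip v c d"
      using u(4) v(3) open_strip_subset by blast
    then show ?thesis
      using strip_width_mono u v by blast
  qed
  then show ?thesis using assms by (meson order_antisym)
qed

lemma width_eq: "plank_of_width w P \<Longrightarrow> width P = w"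
  unfolding width_def by (blast intro: plank_of_width_unique)

lemma interior_closed_strip:
  assumes "u \<noteq> 0"
  shows "interior (closed_strip u a b) = open_strip u a b"
proof -
  have "closed_strip u a b = {x. u \<bullet> x \<ge> a} \<inter> {x. u \<bullet> x \<le> b}"
    by (auto simp: closed_strip_def inner_commute[of _ u])
  then show ?thesis
    using assms interior_halfspace_le[of u b] interior_halfspace_ge[of u a]
    by (auto simp: open_strip_def inner_commute[of _ u])
qed

lemma closed_closed_strip: "closed (closed_strip u a b)"
proof -
  have "closed_strip u a b = {x. u \<bullet> x \<ge> a} \<inter> {x. u \<bullet> x \<le> b}"
    by (auto simp: closed_strip_def inner_commute[of _ u])
  then show ?thesis
    by (simp add: closed_Int closed_halfspace_le closed_halfspace_ge)
qed

lemma convex_closed_strip: "convex (closed_strip u a b)"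
proof -
  have "closed_strip u a b = {x. u \<bullet> x \<ge> a} \<inter> {x. u \<bullet> x \<le> b}"
    by (auto simp: closed_strip_def inner_commute[of _ u])
  then show ?thesis
    by (simp add: convex_Int convex_halfspace_le convex_halfspace_ge)
qed

lemma frontier_strip:
  fixes u :: "'a::euclidean_space"
  assumes u: "norm u = 1" and ab: "a < b"
  shows "frontier (closed_strip u a b) = hyperplane u a \<union> hyperplane u b"
    and "frontier (open_strip u a b) = hyperplane u a \<union> hyperplane u b"
proof -
  have int: "interior (closed_strip u a b) = open_strip u a b"
    using u by (intro interior_closed_strip) auto
  have uu: "u \<bullet> u = 1" using u by (simp add: dot_square_norm)
  have diff: "closed_strip u a b - open_strip u a b = hyperplane u a \<union> hyperplane u b"
    using ab by (auto simp: closed_strip_def open_strip_def hyperplane_def)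
  have "((a + b) / 2) *\<^sub>R u \<in> open_strip u a b"
    using ab by (auto simp: open_strip_def uu)
  then have "interior (closed_strip u a b) \<noteq> {}" using int by auto
  then have cl: "closure (open_strip u a b) = closed_strip u a b"
    using convex_closure_interior[OF convex_closed_strip] closed_closed_strip int
    by (metis closure_closed)
  have op: "interior (open_strip u a b) = open_strip u a b"
    using int by (metis interior_interior)
  show "frontier (closed_strip u a b) = hyperplane u a \<union> hyperplane u b"
    using diff int by (simp add: frontier_def closure_closed closed_closed_strip)
  show "frontier (open_strip u a b) = hyperplane u a \<union> hyperplane u b"
    using diff cl op by (simp add: frontier_def)
qed

end

theory Submission
  imports Defs
begin

text \<open>
  Let \<^term>\<open>w = W / 2\<close>, and let the planks have unit normals \<open>u\<^sub>i\<close> and half-widths \<open>h\<^sub>i\<close>, so that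
  \<open>\<Sum> h\<^sub>i = w\<close>. Call the lens of a unit vector \<open>v\<close> the intersection of the unit balls around \<open>w v\<close>
  and \<open>- w v\<close>. The part of the ball outside the central plank with normal \<open>v\<close> consists of two caps, and
  these can be pushed together into the lens of \<open>v\<close> (\<open>measure_caps_le_lens\<close>). So an optimal family
  leaves uncovered at most the volume of every lens (\<open>uncovered_le_lens\<close>). The reverse inequality holds for
  every family, and equality in it is what gives the theorem.

  For signs \<open>\<epsilon>\<close> let \<open>z\<^sub>\<epsilon> = \<Sum> \<epsilon>\<^sub>i h\<^sub>i u\<^sub>i\<close>, and let \<open>K\<close> be the set of the \<open>x\<close> for which all \<open>x + z\<^sub>\<epsilon>\<close>
  lie in the ball. Bang's argument chooses, for a given \<open>x\<close>, signs that maximise a quadratic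
  expression, and shows that \<open>x + z\<^sub>\<epsilon>\<close> then avoids every open plank (\<open>bang_avoids_strip\<close>). The maximum is,
  up to a function of \<open>x\<close> alone, a convex function with gradient \<open>z\<^sub>\<epsilon>\<close>. Hence \<open>x \<mapsto> x + z\<^sub>\<epsilon>\<close> is a
  strictly monotone map, in particular injective, and it is piecewise a translation
  (\<open>bang_injective\<close>). It follows that the uncovered volume is at least the volume of \<open>K\<close>
  (\<open>measure_erosion_le\<close>).

  The convex hull of the \<open>z\<^sub>\<epsilon>\<close> is the mean, with weights \<open>h\<^sub>i / w\<close>, of the segments from \<open>- w u\<^sub>i\<close>
  to \<open>w u\<^sub>i\<close>. So \<open>K\<close> contains the Minkowski mean, with the same weights, of the lenses of the \<open>u\<^sub>i\<close>
  (\<open>lens_mean_subset\<close>), and by the Brunn--Minkowski inequality this mean has at least the volume of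
  the smallest of them (\<open>lens_mean_properties\<close>).

  For an optimal family all these volumes agree. Then \<open>K\<close> equals the mean of the lenses, because
  a convex body with interior points has no proper compact subset of the same volume, and this forces
  all normals to be parallel to one vector \<open>v\<close> (\<open>parallel_if_erosion_eq\<close>). Moreover the image of Bang's map fills the uncovered part of
  the ball up to a null set. This image is compact and contains no point \<open>y\<close> of the sphere with
  \<open>\<bar>y \<bullet> v\<bar> < w\<close> (\<open>sphere_point_not_in_bang_image\<close>), so the closed planks cover the slab
  \<open>\<bar>x \<bullet> v\<bar> < w\<close>. The total width leaves no room for anything else (\<open>interval_cover_excess\<close>).
\<close>

section \<open>The Brunn--Minkowski inequality\<close>

text \<open>Disjointness is that of open boxes, so the boundaries between neighbouring boxes of a packing are
  not covered; the cuts below lose only null sets in the same way.\<close>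
definition box_packing :: "'a::euclidean_space set set \<Rightarrow> bool" where
  "box_packing F \<longleftrightarrow> finite F \<and> disjoint F \<and> (\<forall>K\<in>F. K \<noteq> {} \<and> (\<exists>a b. K = box a b))"

lemma box_packing_Union:
  assumes "box_packing F"
  shows "open (\<Union>F)" "bounded (\<Union>F)" "\<Union>F \<in> lmeasurable"
proof -
  show "open (\<Union>F)" using assms by (auto simp: box_packing_def open_box intro!: open_Union) 
  show "bounded (\<Union>F)" using assms by (auto simp: box_packing_def intro!: bounded_Union)
  then show "\<Union>F \<in> lmeasurable" using \<open>open (\<Union>F)\<close> by (rule lmeasurable_open)
qed

lemma box_halfspace_lt:
  fixes a b :: "'a::euclidean_space"
  assumes "i \<in> Basis"
  shows "\<exists>a' b'. box a b \<inter> {x. x \<bullet> i < c} = box a' b'"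
proof -
  have "box a b \<inter> {x. x \<bullet> i < c} = box a (b + (min (b \<bullet> i) c - b \<bullet> i) *\<^sub>R i)"
    using assms by (auto simp: mem_box inner_simps inner_Basis split: if_splits)
  then show ?thesis by blast
qed

lemma box_halfspace_gt:
  fixes a b :: "'a::euclidean_space"
  assumes "i \<in> Basis"
  shows "\<exists>a' b'. box a b \<inter> {x. c < x \<bullet> i} = box a' b'"
proof -
  have "box a b \<inter> {x. c < x \<bullet> i} = box (a + (max (a \<bullet> i) c - a \<bullet> i) *\<^sub>R i) b"
    using assms by (auto simp: mem_box inner_simps inner_Basis split: if_splits)
  then show ?thesis by blast
qed

text \<open>A cut that misses one of the boxes lowers their number; this is what makes the induction in
  the Brunn--Minkowski inequality for packings terminate.\<close>
lemma box_packing_cut: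
  fixes F :: "'a::euclidean_space set set"
  assumes F: "box_packing F"
    and H: "\<And>a b. \<exists>a' b'. box a b \<inter> H = box a' (b'::'a)"
  shows "\<exists>F'. box_packing F' \<and> \<Union>F' = \<Union>F \<inter> H \<and> card F' \<le> card F \<and>
    (\<forall>K\<in>F. K \<inter> H = {} \<longrightarrow> card F' < card F)"
proof (intro exI conjI ballI impI)
  let ?F' = "(\<lambda>K. K \<inter> H) ` {K\<in>F. K \<inter> H \<noteq> {}}"
  have fin: "finite F" using F by (simp add: box_packing_def)
  show "box_packing ?F'"
    using F unfolding box_packing_def
  proof (intro conjI, goal_cases)
    case 2
    then show ?case by (fastforce simp: disjoint_def)
  next
    case 3
    show ?case
    proof
      fix K assume "K \<in> ?F'"
      then obtain L where L: "L \<in> F" "K = L \<inter> H" "K \<noteq> {}" by auto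
      moreover obtain a b where "L = box a b" using 3 L by metis
      ultimately show "K \<noteq> {} \<and> (\<exists>a b. K = box a b)" using H[of a b] by auto
    qed
  qed auto
  show "\<Union>?F' = \<Union>F \<inter> H" by auto
  show "card ?F' \<le> card F"
    using fin by (metis (no_types, lifting) card_image_le card_mono finite_subset le_trans mem_Collect_eq subsetI)
  fix K assume K: "K \<in> F" "K \<inter> H = {}"
  have "card ?F' \<le> card {K\<in>F. K \<inter> H \<noteq> {}}" using fin by (intro card_image_le) auto
  also have "\<dots> < card F" using fin K by (intro psubset_card_mono) auto
  finally show "card ?F' < card F" .
qed

lemma lmeasurable_Int_open:
  assumes "S \<in> lmeasurable" "open T" shows "S \<inter> T \<in> lmeasurable"
  using assms by (intro fmeasurable_Int_fmeasurable) auto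

lemma measure_Un_disjoint:
  assumes "A \<in> fmeasurable M" "B \<in> fmeasurable M" "A \<inter> B = {}"
  shows "measure M (A \<union> B) = measure M A + measure M B"
  using assms by (simp add: measure_Un3)

lemma measure_coordinate_cut:
  fixes S :: "'a::euclidean_space set"
  assumes S: "S \<in> lmeasurable" and i: "i \<in> Basis"
  shows "measure lebesgue S
    = measure lebesgue (S \<inter> {x. x \<bullet> i < c}) + measure lebesgue (S \<inter> {x. c < x \<bullet> i})"
proof -
  have m: "S \<inter> {x. x \<bullet> i < c} \<in> lmeasurable" "S \<inter> {x. c < x \<bullet> i} \<in> lmeasurable"
    by (intro lmeasurable_Int_open S open_halfspace_component_lt open_halfspace_component_gt)+
  have n: "negligible {x. x \<bullet> i = c}"
    using i by (rule negligible_standard_hyperplane)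
  have "measure lebesgue S = measure lebesgue (S \<inter> {x. x \<bullet> i < c} \<union> S \<inter> {x. c < x \<bullet> i})"
    by (rule measure_negligible_symdiff[symmetric, OF S, of _]) (rule negligible_subset[OF n], auto)
  also have "\<dots> = measure lebesgue (S \<inter> {x. x \<bullet> i < c}) + measure lebesgue (S \<inter> {x. c < x \<bullet> i})"
  proof -
    have "S \<inter> {x. x \<bullet> i < c} \<inter> (S \<inter> {x. c < x \<bullet> i}) = {}" by auto
    then show ?thesis using m by (simp add: measure_Un3)
  qed
  finally show ?thesis .
qed

text \<open>A bounded set has slabs of volume at most linear in their thickness, so the volume cut off by a
  coordinate hyperplane is a Lipschitz function of its position. This is the continuity needed to
  cut a set in a prescribed proportion.\<close>
lemma measure_coordinate_slab_le:
  fixes S :: "'a::euclidean_space set"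
  assumes "bounded S" and i: "i \<in> Basis"
    and m: "\<And>c c'. S \<inter> {x. c \<le> x \<bullet> i \<and> x \<bullet> i < c'} \<in> lmeasurable"
  shows "\<exists>N. \<forall>c c'. c \<le> c' \<longrightarrow>
      measure lebesgue (S \<inter> {x. c \<le> x \<bullet> i \<and> x \<bullet> i < c'}) \<le> N * (c' - c)"
proof -
  obtain p q where pq: "S \<subseteq> cbox p q" using assms(1) bounded_subset_cbox_symmetric by blast
  show ?thesis
  proof (intro exI[of _ "\<Prod>j\<in>Basis - {i}. \<bar>q \<bullet> j - p \<bullet> j\<bar>"] allI impI)
    fix c c' :: real assume c: "c \<le> c'"
    define p' q' where "p' = p + (c - p \<bullet> i) *\<^sub>R i" and "q' = q + (c' - q \<bullet> i) *\<^sub>R i"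
    have comp: "p' \<bullet> j = (if j = i then c else p \<bullet> j)" "q' \<bullet> j = (if j = i then c' else q \<bullet> j)"
      if "j \<in> Basis" for j
      using that i by (auto simp: p'_def q'_def inner_simps inner_Basis)
    have sub: "S \<inter> {x. c \<le> x \<bullet> i \<and> x \<bullet> i < c'} \<subseteq> cbox p' q'"
      using pq comp by (auto simp: mem_box)
    have "measure lebesgue (S \<inter> {x. c \<le> x \<bullet> i \<and> x \<bullet> i < c'}) \<le> measure lebesgue (cbox p' q')"
      by (rule measure_mono_fmeasurable[OF sub fmeasurableD[OF m]]) simp
    also have "\<dots> \<le> (\<Prod>j\<in>Basis. \<bar>q' \<bullet> j - p' \<bullet> j\<bar>)"
      by (auto simp: content_cbox_if prod_nonneg box_ne_empty simp del: box_eq_empty intro!: prod_mono)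
    also have "\<dots> = (c' - c) * (\<Prod>j\<in>Basis - {i}. \<bar>q' \<bullet> j - p' \<bullet> j\<bar>)"
      using i c by (simp add: prod.remove[of Basis i] comp)
    also have "(\<Prod>j\<in>Basis - {i}. \<bar>q' \<bullet> j - p' \<bullet> j\<bar>) = (\<Prod>j\<in>Basis - {i}. \<bar>q \<bullet> j - p \<bullet> j\<bar>)"
      by (rule prod.cong) (auto simp: comp)
    finally show "measure lebesgue (S \<inter> {x. c \<le> x \<bullet> i \<and> x \<bullet> i < c'})
        \<le> (\<Prod>j\<in>Basis - {i}. \<bar>q \<bullet> j - p \<bullet> j\<bar>) * (c' - c)" by (simp add: mult.commute)
  qed
qed

lemma exists_cut_proportion:
  fixes S :: "'a::euclidean_space set"
  assumes S: "S \<in> lmeasurable" and bS: "bounded S" and i: "i \<in> Basis" and p: "0 \<le> p" "p \<le> 1"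
  obtains c where "measure lebesgue (S \<inter> {x. x \<bullet> i < c}) = p * measure lebesgue S"
proof -
  define g where "g c = measure lebesgue (S \<inter> {x. x \<bullet> i < c})" for c
  have m: "S \<inter> {x. x \<bullet> i < c} \<in> lmeasurable" for c
    by (intro lmeasurable_Int_open S open_halfspace_component_lt)
  have m2: "S \<inter> {x. c \<le> x \<bullet> i \<and> x \<bullet> i < c'} \<in> lmeasurable" for c c'
  proof -
    have "S \<inter> {x. c \<le> x \<bullet> i \<and> x \<bullet> i < c'} = S \<inter> {x. x \<bullet> i < c'} - S \<inter> {x. x \<bullet> i < c}" by auto
    then show ?thesis using m[of c] m[of c'] by (simp only: fmeasurable.Diff)
  qed
  obtain N where N: "\<And>c c'. c \<le> c' \<Longrightarrow> measure lebesgue (S \<inter> {x. c \<le> x \<bullet> i \<and> x \<bullet> i < c'}) \<le> N * (c' - c)"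
    using measure_coordinate_slab_le[OF bS i m2] by blast
  have diff: "g c' - g c = measure lebesgue (S \<inter> {x. c \<le> x \<bullet> i \<and> x \<bullet> i < c'})" if "c \<le> c'" for c c'
  proof -
    have "g c' = measure lebesgue (S \<inter> {x. x \<bullet> i < c} \<union> S \<inter> {x. c \<le> x \<bullet> i \<and> x \<bullet> i < c'})"
      unfolding g_def using that by (intro arg_cong[where f="measure lebesgue"]) auto
    also have "\<dots> = g c + measure lebesgue (S \<inter> {x. c \<le> x \<bullet> i \<and> x \<bullet> i < c'})"
    proof -
      have "S \<inter> {x. x \<bullet> i < c} \<inter> (S \<inter> {x. c \<le> x \<bullet> i \<and> x \<bullet> i < c'}) = {}" by auto
      then show ?thesis unfolding g_def using m[of c] m2[of c c'] by (simp add: measure_Un3)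
    qed
    finally show ?thesis by simp
  qed
  have lip: "\<bar>g c' - g c\<bar> \<le> N * \<bar>c' - c\<bar>" for c c'
  proof (cases "c \<le> c'")
    case True
    have "0 \<le> g c' - g c" unfolding diff[OF True] by (rule measure_nonneg)
    moreover have "g c' - g c \<le> N * (c' - c)" unfolding diff[OF True] by (rule N[OF True])
    ultimately show ?thesis using True by simp
  next
    case False
    then have le: "c' \<le> c" by simp
    have "0 \<le> g c - g c'" unfolding diff[OF le] by (rule measure_nonneg)
    moreover have "g c - g c' \<le> N * (c - c')" unfolding diff[OF le] by (rule N[OF le])
    ultimately show ?thesis using le by simp
  qed
  have N0: "0 \<le> N" using order_trans[OF abs_ge_zero lip[of 1 0]] by simp
  have "lipschitz_on N UNIV g" using lip N0 by (intro lipschitz_onI) (auto simp: dist_real_def)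
  then have cont: "continuous_on UNIV g" by (rule lipschitz_on_continuous_on)
  obtain r where r: "\<And>x. x \<in> S \<Longrightarrow> norm x \<le> r" using bS bounded_iff by metis
  have r': "\<bar>x \<bullet> i\<bar> \<le> r" if "x \<in> S" for x
    using Basis_le_norm[OF i, of x] r[OF that] by simp
  have lo: "S \<inter> {x. x \<bullet> i < - \<bar>r\<bar>} = {}"
  proof -
    have "\<not> x \<bullet> i < - \<bar>r\<bar>" if "x \<in> S" for x using r'[OF that] by linarith
    then show ?thesis by blast
  qed
  have hi: "S \<inter> {x. x \<bullet> i < \<bar>r\<bar> + 1} = S"
  proof -
    have "x \<bullet> i < \<bar>r\<bar> + 1" if "x \<in> S" for x using r'[OF that] by linarith
    then show ?thesis by blast
  qed
  have "\<exists>c\<ge>-\<bar>r\<bar>. c \<le> \<bar>r\<bar> + 1 \<and> g c = p * measure lebesgue S"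
  proof (rule IVT')
    show "g (- \<bar>r\<bar>) \<le> p * measure lebesgue S" using p by (simp add: g_def lo)
    show "p * measure lebesgue S \<le> g (\<bar>r\<bar> + 1)" using p by (simp add: g_def hi mult_left_le_one_le)
    show "continuous_on {- \<bar>r\<bar>..\<bar>r\<bar> + 1} g" using cont continuous_on_subset by blast
  qed simp
  then show ?thesis using that unfolding g_def by blast
qed

lemma open_set_plus:
  fixes A B :: "'a::real_normed_vector set"
  assumes "open A" shows "open (A + B)"
proof -
  have "A + B = (\<Union>b\<in>B. (+) b ` A)" by (auto simp: set_plus_def image_iff) (metis add.commute)+
  then show ?thesis using assms by (auto intro: open_translation)
qed

lemma bounded_set_plus:
  fixes A B :: "'a::real_normed_vector set"
  assumes "bounded A" "bounded B" shows "bounded (A + B)"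
proof -
  have "A + B = (\<Union>x\<in>A. \<Union>y\<in>B. {x + y})" by (auto simp: set_plus_def)
  then show ?thesis by (simp only: bounded_sums[OF assms])
qed

lemma box_subset_set_plus:
  fixes a b c d :: "'a::euclidean_space"
  assumes "box a b \<noteq> {}" "box c d \<noteq> {}"
  shows "box (a + c) (b + d) \<subseteq> box a b + box c d"
proof
  fix z assume z: "z \<in> box (a + c) (b + d)"
  have ab: "a \<bullet> i < b \<bullet> i" and cd: "c \<bullet> i < d \<bullet> i" if "i \<in> Basis" for i
    using assms that by (auto simp: box_ne_empty)
  define l where "l i = (z \<bullet> i - (a + c) \<bullet> i) / ((b + d) \<bullet> i - (a + c) \<bullet> i)" for i
  define x where "x = (\<Sum>i\<in>Basis. (a \<bullet> i + l i * (b \<bullet> i - a \<bullet> i)) *\<^sub>R i)"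
  have l: "0 < l i" "l i < 1" "z \<bullet> i = (a + c) \<bullet> i + l i * ((b + d) \<bullet> i - (a + c) \<bullet> i)" if "i \<in> Basis" for i
    using z ab[OF that] cd[OF that] that by (auto simp: l_def mem_box field_simps inner_simps)
  have xi: "x \<bullet> i = a \<bullet> i + l i * (b \<bullet> i - a \<bullet> i)" if "i \<in> Basis" for i
    using that by (simp add: x_def)
  have zi: "(z - x) \<bullet> i = c \<bullet> i + l i * (d \<bullet> i - c \<bullet> i)" if "i \<in> Basis" for i
    using that xi[OF that] l(3)[OF that] by (simp add: inner_simps algebra_simps)
  have *: "u < u + t * (v - u) \<and> u + t * (v - u) < v" if "u < v" "0 < t" "t < 1" for u v t :: real
  proof -
    have "0 < t * (v - u)" "t * (v - u) < 1 * (v - u)"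
      using that by (auto intro!: mult_strict_right_mono)
    then show ?thesis by (simp add: algebra_simps)
  qed
  have "x \<in> box a b" "z - x \<in> box c d"
    using * l ab cd by (auto simp: mem_box xi zi)
  then have "x + (z - x) \<in> box a b + box c d" by (rule set_plus_intro)
  then show "z \<in> box a b + box c d" by simp
qed

text \<open>The Brunn--Minkowski inequality for two boxes with edge lengths \<^term>\<open>f i\<close> and \<^term>\<open>g i\<close>. After
  division by \<^term>\<open>a\<close> and \<^term>\<open>b\<close> it is the weighted inequality of arithmetic and geometric means,
  applied in each factor with the weights \<^term>\<open>a / (a + b)\<close> and \<^term>\<open>b / (a + b)\<close>.\<close>
lemma prod_ge_power_imp_prod_plus_ge:
  fixes f g :: "'i \<Rightarrow> real"
  assumes I: "finite I" and f: "\<And>i. i \<in> I \<Longrightarrow> 0 < f i" and g: "\<And>i. i \<in> I \<Longrightarrow> 0 < g i"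
    and a: "0 < a" and b: "0 < b" and s: "0 < s"
    and F: "a ^ card I * s \<le> (\<Prod>i\<in>I. f i)" and G: "b ^ card I * s \<le> (\<Prod>i\<in>I. g i)"
  shows "(a + b) ^ card I * s \<le> (\<Prod>i\<in>I. f i + g i)"
proof -
  define \<alpha> \<beta> where "\<alpha> = a / (a + b)" and "\<beta> = b / (a + b)"
  have ab: "0 \<le> \<alpha>" "0 \<le> \<beta>" "\<alpha> + \<beta> = 1" using a b by (auto simp: \<alpha>_def \<beta>_def add_divide_distrib[symmetric])
  have Ps: "s \<le> (\<Prod>i\<in>I. f i / a)" "s \<le> (\<Prod>i\<in>I. g i / b)"
    using F G a b by (auto simp: prod_dividef field_simps)
  have "(a + b) ^ card I * s = (a + b) ^ card I * (s powr \<alpha> * s powr \<beta>)"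
    using ab s by (simp flip: powr_add)
  also have "\<dots> \<le> (a + b) ^ card I * ((\<Prod>i\<in>I. f i / a) powr \<alpha> * (\<Prod>i\<in>I. g i / b) powr \<beta>)"
    using Ps s a b ab by (intro mult_left_mono mult_mono powr_mono2) auto
  also have "\<dots> = (\<Prod>i\<in>I. (a + b) * ((f i / a) powr \<alpha> * (g i / b) powr \<beta>))"
    using f g a b by (simp add: prod.distrib prod_powr_distrib less_imp_le)
  also have "\<dots> \<le> (\<Prod>i\<in>I. f i + g i)"
  proof (intro prod_mono conjI)
    fix i assume i: "i \<in> I"
    show "0 \<le> (a + b) * ((f i / a) powr \<alpha> * (g i / b) powr \<beta>)" using a b by simp
    have "(a + b) * ((f i / a) powr \<alpha> * (g i / b) powr \<beta>) \<le> (a + b) * (\<alpha> * (f i / a) + \<beta> * (g i / b))"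
      using ab f[OF i] g[OF i] a b by (intro mult_left_mono Youngs_inequality_0) auto
    also have "\<dots> = f i + g i"
    proof -
      have "\<alpha> * (f i / a) = f i / (a + b)" "\<beta> * (g i / b) = g i / (a + b)"
        using a b by (simp_all add: \<alpha>_def \<beta>_def)
      then show ?thesis using a b by (simp add: add_divide_distrib[symmetric])
    qed
    finally show "(a + b) * ((f i / a) powr \<alpha> * (g i / b) powr \<beta>) \<le> f i + g i" .
  qed
  finally show ?thesis .
qed

lemma measure_box_packing_pos:
  assumes "box_packing F" "F \<noteq> {}"
  shows "0 < measure lebesgue (\<Union>F)"
proof -
  have "\<Union>F \<noteq> {}" using assms by (auto simp: box_packing_def)
  then have "\<not> negligible (\<Union>F)" using box_packing_Union(1)[OF assms(1)] open_not_negligible by blast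
  then show ?thesis
    using negligible_iff_measure0[OF box_packing_Union(3)[OF assms(1)]] zero_less_measure_iff by blast
qed

lemma box_packing_plus_lmeasurable:
  assumes "box_packing F" "box_packing G"
  shows "\<Union>F + \<Union>G \<in> lmeasurable"
  using assms by (intro lmeasurable_open bounded_set_plus open_set_plus box_packing_Union)

text \<open>The step of Hadwiger and Ohmann. A coordinate hyperplane separates two boxes of \<^term>\<open>F\<close>, and a
  parallel one is chosen so that it cuts \<^term>\<open>G\<close> in the same proportion. The sums of corresponding
  parts lie on different sides of a third hyperplane, hence are disjoint, and the bound for the two
  parts adds up to the bound for the whole because all three bounds are linear in \<^term>\<open>s\<close>.\<close>
lemma brunn_minkowski_packing_step:
  fixes F G :: "'a::euclidean_space set set"
  assumes F: "box_packing F" "K1 \<in> F" "K2 \<in> F" "K1 \<noteq> K2" and G: "box_packing G" "G \<noteq> {}"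
    and a: "0 < a" and b: "0 < b" and s: "0 < s"
    and FA: "a ^ DIM('a) * s \<le> measure lebesgue (\<Union>F)"
    and GB: "b ^ DIM('a) * s \<le> measure lebesgue (\<Union>G)"
    and IH: "\<And>(F' :: 'a set set) (G' :: 'a set set) s'. box_packing F' \<Longrightarrow> box_packing G' \<Longrightarrow> F' \<noteq> {} \<Longrightarrow> G' \<noteq> {} \<Longrightarrow>
      card F' < card F \<Longrightarrow> card G' \<le> card G \<Longrightarrow> 0 < s' \<Longrightarrow>
      a ^ DIM('a) * s' \<le> measure lebesgue (\<Union>F') \<Longrightarrow>
      b ^ DIM('a) * s' \<le> measure lebesgue (\<Union>G') \<Longrightarrow>
      (a + b) ^ DIM('a) * s' \<le> measure lebesgue (\<Union>F' + \<Union>G')"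
  shows "(a + b) ^ DIM('a) * s \<le> measure lebesgue (\<Union>F + \<Union>G)"
proof -
  let ?\<mu> = "measure lebesgue"
  note mF = box_packing_Union[OF F(1)] and mG = box_packing_Union[OF G(1)]
  have "\<exists>i\<in>Basis. \<exists>c. \<exists>K\<in>F. \<exists>L\<in>F. (\<forall>x\<in>K. x \<bullet> i < c) \<and> (\<forall>x\<in>L. c < x \<bullet> i)"
  proof -
    obtain p q p' q' where pq: "K1 = box p q" "K2 = box p' q'"
      using F unfolding box_packing_def by metis
    have ne: "box p q \<noteq> {}" "box p' q' \<noteq> {}" using F pq unfolding box_packing_def by metis+
    have "box p q \<inter> box p' q' = {}"
      using F pq unfolding box_packing_def disjoint_def by blast
    then obtain i where i: "i \<in> Basis"
      "q \<bullet> i \<le> p \<bullet> i \<or> q' \<bullet> i \<le> p' \<bullet> i \<or> q \<bullet> i \<le> p' \<bullet> i \<or> q' \<bullet> i \<le> p \<bullet> i"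
      using disjoint_interval(4) by blast
    have lt: "p \<bullet> i < q \<bullet> i" "p' \<bullet> i < q' \<bullet> i"
      using ne i(1) unfolding box_ne_empty by blast+
    have mem: "p \<bullet> i < x \<bullet> i \<and> x \<bullet> i < q \<bullet> i" if "x \<in> K1" for x
      using that i(1) unfolding pq mem_box by blast
    have mem': "p' \<bullet> i < x \<bullet> i \<and> x \<bullet> i < q' \<bullet> i" if "x \<in> K2" for x
      using that i(1) unfolding pq mem_box by blast
    have "q \<bullet> i \<le> p' \<bullet> i \<or> q' \<bullet> i \<le> p \<bullet> i" using lt i(2) by linarith
    then show ?thesis
    proof
      assume "q \<bullet> i \<le> p' \<bullet> i"
      then have "(\<forall>x\<in>K1. x \<bullet> i < q \<bullet> i) \<and> (\<forall>x\<in>K2. q \<bullet> i < x \<bullet> i)"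
        using mem mem' by (meson order_le_less_trans)
      then show ?thesis using i(1) F(2,3) by blast
    next
      assume "q' \<bullet> i \<le> p \<bullet> i"
      then have "(\<forall>x\<in>K2. x \<bullet> i < q' \<bullet> i) \<and> (\<forall>x\<in>K1. q' \<bullet> i < x \<bullet> i)"
        using mem mem' by (meson order_le_less_trans)
      then show ?thesis using i(1) F(2,3) by blast
    qed
  qed
  then obtain i c K L where i: "i \<in> Basis" and K: "K \<in> F" "\<forall>x\<in>K. x \<bullet> i < c" and L: "L \<in> F" "\<forall>x\<in>L. c < x \<bullet> i"
    by blast
  have KL0: "K \<noteq> {}" "L \<noteq> {}" using F K L by (auto simp: box_packing_def)
  from box_packing_cut[OF F(1) box_halfspace_lt[OF i, of _ _ c]] obtain F1
    where F1: "box_packing F1" "\<Union>F1 = \<Union>F \<inter> {x. x \<bullet> i < c}"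
      and card1: "\<forall>K\<in>F. K \<inter> {x. x \<bullet> i < c} = {} \<longrightarrow> card F1 < card F"
    by (elim exE conjE)
  from box_packing_cut[OF F(1) box_halfspace_gt[OF i, of _ _ c]] obtain F2
    where F2: "box_packing F2" "\<Union>F2 = \<Union>F \<inter> {x. c < x \<bullet> i}"
      and card2: "\<forall>K\<in>F. K \<inter> {x. c < x \<bullet> i} = {} \<longrightarrow> card F2 < card F"
    by (elim exE conjE)
  have c1: "card F1 < card F" using L by (intro card1[rule_format, of L]) auto
  have c2: "card F2 < card F" using K by (intro card2[rule_format, of K]) auto
  have ne1: "F1 \<noteq> {}" using F1(2) K KL0 by fastforce
  have ne2: "F2 \<noteq> {}" using F2(2) L KL0 by fastforce
  note pos = measure_box_packing_pos
  have posF: "0 < ?\<mu> (\<Union>F)" using pos F by blast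
  have posG: "0 < ?\<mu> (\<Union>G)" using pos G by blast
  have splitF: "?\<mu> (\<Union>F) = ?\<mu> (\<Union>F1) + ?\<mu> (\<Union>F2)"
    unfolding F1 F2 by (rule measure_coordinate_cut[OF mF(3) i])
  define t where "t = ?\<mu> (\<Union>F1) / ?\<mu> (\<Union>F)"
  have t: "0 < t" "t < 1"
    using pos[OF F1(1) ne1] pos[OF F2(1) ne2] posF splitF by (auto simp: t_def)
  have tF: "?\<mu> (\<Union>F1) = t * ?\<mu> (\<Union>F)" "?\<mu> (\<Union>F2) = (1 - t) * ?\<mu> (\<Union>F)"
    using posF splitF by (auto simp: t_def field_simps)
  obtain e where e: "?\<mu> (\<Union>G \<inter> {x. x \<bullet> i < e}) = t * ?\<mu> (\<Union>G)"
    using exists_cut_proportion[OF mG(3,2) i, of t] t by auto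
  from box_packing_cut[OF G(1) box_halfspace_lt[OF i, of _ _ e]] obtain G1
    where G1: "box_packing G1" "\<Union>G1 = \<Union>G \<inter> {x. x \<bullet> i < e}" "card G1 \<le> card G"
    by (elim exE conjE)
  from box_packing_cut[OF G(1) box_halfspace_gt[OF i, of _ _ e]] obtain G2
    where G2: "box_packing G2" "\<Union>G2 = \<Union>G \<inter> {x. e < x \<bullet> i}" "card G2 \<le> card G"
    by (elim exE conjE)
  have tG: "?\<mu> (\<Union>G1) = t * ?\<mu> (\<Union>G)" "?\<mu> (\<Union>G2) = (1 - t) * ?\<mu> (\<Union>G)"
    using e measure_coordinate_cut[OF mG(3) i, of e] by (auto simp: G1 G2 algebra_simps)
  have neG: "G1 \<noteq> {}" "G2 \<noteq> {}"
    using tG t posG by auto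
  have *: "x * (r * s) \<le> r * m" if "x * s \<le> m" "0 < r" for x r m :: real
    using mult_left_mono[OF that(1), of r] that(2) by (simp add: ac_simps)
  have I1: "(a + b) ^ DIM('a) * (t * s) \<le> ?\<mu> (\<Union>F1 + \<Union>G1)"
    using t s by (intro IH[OF F1(1) G1(1) ne1 neG(1) c1 G1(3)]) (simp_all add: tF tG *[OF FA] *[OF GB])
  have I2: "(a + b) ^ DIM('a) * ((1 - t) * s) \<le> ?\<mu> (\<Union>F2 + \<Union>G2)"
    using t s by (intro IH[OF F2(1) G2(1) ne2 neG(2) c2 G2(3)]) (simp_all add: tF tG *[OF FA] *[OF GB])
  have m: "\<Union>F1 + \<Union>G1 \<in> lmeasurable" "\<Union>F2 + \<Union>G2 \<in> lmeasurable" "\<Union>F + \<Union>G \<in> lmeasurable"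
    by (intro box_packing_plus_lmeasurable F1 G1 F2 G2 F(1) G(1))+
  have "(a + b) ^ DIM('a) * s = (a + b) ^ DIM('a) * (t * s) + (a + b) ^ DIM('a) * ((1 - t) * s)"
    by (simp add: algebra_simps)
  also have "\<dots> \<le> ?\<mu> (\<Union>F1 + \<Union>G1) + ?\<mu> (\<Union>F2 + \<Union>G2)"
    using I1 I2 by (rule add_mono)
  also have "\<dots> = ?\<mu> ((\<Union>F1 + \<Union>G1) \<union> (\<Union>F2 + \<Union>G2))"
  proof -
    have "(\<Union>F1 + \<Union>G1) \<inter> (\<Union>F2 + \<Union>G2) = {}"
    proof -
      have "x \<bullet> i < c + e" if "x \<in> \<Union>F1 + \<Union>G1" for x
        using that by (auto simp: F1 G1 inner_simps elim!: set_plus_elim)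
      moreover have "c + e < x \<bullet> i" if "x \<in> \<Union>F2 + \<Union>G2" for x
        using that by (auto simp: F2 G2 inner_simps elim!: set_plus_elim)
      ultimately show ?thesis by (meson disjoint_iff less_asym)
    qed
    then show ?thesis using m by (simp add: measure_Un3)
  qed
  also have "\<dots> \<le> ?\<mu> (\<Union>F + \<Union>G)"
    using m by (intro measure_mono_fmeasurable Un_least set_plus_mono2) (auto simp: F1 F2 G1 G2)
  finally show ?thesis .
qed

text \<open>The inequality is stated with \<^term>\<open>a\<close>, \<^term>\<open>b\<close> and \<^term>\<open>s\<close> instead of \<^term>\<open>d\<close>-th roots of volumes: this
  form is symmetric in the two sets and survives cutting both in the same proportion, where only
  \<^term>\<open>s\<close> changes.\<close>
lemma brunn_minkowski_packing:
  fixes F G :: "'a::euclidean_space set set"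
  assumes "box_packing F" "F \<noteq> {}" "box_packing G" "G \<noteq> {}" and "0 < a" "0 < b" "0 < s"
    and "a ^ DIM('a) * s \<le> measure lebesgue (\<Union>F)"
    and "b ^ DIM('a) * s \<le> measure lebesgue (\<Union>G)"
  shows "(a + b) ^ DIM('a) * s \<le> measure lebesgue (\<Union>F + \<Union>G)"
  using assms
proof (induction "card F + card G" arbitrary: F G s rule: less_induct)
  case less
  have fin: "finite F" "finite G" using less.prems by (auto simp: box_packing_def)
  consider K1 K2 where "K1 \<in> F" "K2 \<in> F" "K1 \<noteq> K2" | K1 K2 where "K1 \<in> G" "K2 \<in> G" "K1 \<noteq> K2"
    | K L where "F = {K}" "G = {L}"
    using less.prems by (metis is_singletonI' is_singleton_the_elem)
  then show ?case
  proof cases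
    case 1
    show ?thesis
      by (rule brunn_minkowski_packing_step[OF less.prems(1) 1 less.prems(3-9)])
        (rule less.hyps; use less.prems in auto)
  next
    case 2
    have "(b + a) ^ DIM('a) * s \<le> measure lebesgue (\<Union>G + \<Union>F)"
    proof (rule brunn_minkowski_packing_step[OF less.prems(3) 2 less.prems(1,2,6,5,7,9,8)])
      fix F' G' :: "'a set set" and s' :: real
      assume A: "box_packing F'" "box_packing G'" "F' \<noteq> {}" "G' \<noteq> {}" "card F' < card G" "card G' \<le> card F"
        "0 < s'" "b ^ DIM('a) * s' \<le> measure lebesgue (\<Union> F')" "a ^ DIM('a) * s' \<le> measure lebesgue (\<Union> G')"
      have "(a + b) ^ DIM('a) * s' \<le> measure lebesgue (\<Union>G' + \<Union>F')"
        by (rule less.hyps) (use A less.prems in auto)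
      then show "(b + a) ^ DIM('a) * s' \<le> measure lebesgue (\<Union>F' + \<Union>G')" by (simp add: add.commute)
    qed
    then show ?thesis by (simp add: add.commute)
  next
    case 3
    then obtain p q p' q' where pq: "K = box p q" "L = box p' q'" "box p q \<noteq> {}" "box p' q' \<noteq> {}"
      using less.prems unfolding box_packing_def by (metis insertI1)
    have lt: "p \<bullet> i < q \<bullet> i" "p' \<bullet> i < q' \<bullet> i" if "i \<in> Basis" for i
      using pq that by (auto simp: box_ne_empty)
    have vol: "measure lebesgue (box x y) = (\<Prod>i\<in>Basis. y \<bullet> i - x \<bullet> i)"
      if "\<And>i. i \<in> Basis \<Longrightarrow> x \<bullet> i < y \<bullet> i" for x y :: 'a
      using that by (auto simp: measure_lborel_box_eq less_imp_le inner_simps)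
    have "(a + b) ^ DIM('a) * s \<le> (\<Prod>i\<in>Basis. (q \<bullet> i - p \<bullet> i) + (q' \<bullet> i - p' \<bullet> i))"
      using less.prems lt vol[of p q] vol[of p' q']
      by (intro prod_ge_power_imp_prod_plus_ge) (auto simp: 3 pq)
    also have "\<dots> = measure lebesgue (box (p + p') (q + q'))"
      using lt by (subst vol) (auto simp: inner_simps add_strict_mono intro!: prod.cong)
    also have "\<dots> \<le> measure lebesgue (box p q + box p' q')"
      by (rule measure_mono_fmeasurable[OF box_subset_set_plus[OF pq(3,4)]])
        (auto intro!: lmeasurable_open bounded_set_plus open_set_plus open_box)
    finally show ?thesis by (simp add: 3 pq)
  qed
qed

text \<open>An open set is a countable union of closed boxes; finitely many of them carry almost all of the
  volume and can be divided into boxes with disjoint interiors.\<close>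
lemma open_inner_box_packing:
  fixes S :: "'a::euclidean_space set"
  assumes S: "open S" "S \<in> lmeasurable" and v: "v < measure lebesgue S"
  obtains F where "box_packing F" "\<Union>F \<subseteq> S" "v < measure lebesgue (\<Union>F)"
proof -
  obtain D where D: "countable D" "D \<subseteq> Pow S" "\<And>X. X \<in> D \<Longrightarrow> \<exists>a b. X = cbox a b" "\<Union>D = S"
    using open_countable_Union_open_cbox[OF S(1)] by metis
  define f where "f = from_nat_into (insert {} D)"
  have fD: "range f = insert {} D" unfolding f_def using D by (intro range_from_nat_into) auto
  have fbox: "\<exists>a b. f n = cbox a b" for n
  proof -
    have "f n \<in> insert {} D" using fD by blast
    then show ?thesis using D(3) by (metis empty_as_interval insert_iff)
  qed
  have fS: "f n \<subseteq> S" for n using fD D(2) by (metis PowD empty_subsetI insertE rangeI subsetD)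
  define A where "A n = (\<Union>k\<le>n. f k)" for n
  have mA: "A n \<in> lmeasurable" for n
    unfolding A_def
  proof (rule fmeasurable.finite_UN)
    show "f k \<in> lmeasurable" for k using fbox[of k] by auto
  qed auto
  have "\<Union>(range f) = S" unfolding fD using D(4) by simp
  moreover have "(\<Union>n. A n) = \<Union>(range f)" unfolding A_def by auto
  ultimately have UA: "(\<Union>n. A n) = S" by simp
  have "(\<lambda>n. measure lebesgue (A n)) \<longlonglongrightarrow> measure lebesgue (\<Union>n. A n)"
  proof (rule Lim_measure_incseq)
    show "range A \<subseteq> sets lebesgue" using mA by (auto dest: fmeasurableD)
    show "incseq A" unfolding A_def incseq_def by (intro allI impI UN_mono) auto
    show "emeasure lebesgue (\<Union>n. A n) \<noteq> \<infinity>" using S UA by (auto simp: fmeasurable_def)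
  qed
  then have "\<forall>\<^sub>F n in sequentially. v < measure lebesgue (A n)"
    using v UA by (metis order_tendstoD(1))
  then obtain n where n: "v < measure lebesgue (A n)" by (auto simp: eventually_sequentially)
  obtain P where P: "P division_of (A n)"
    unfolding A_def by (rule elementary_unions_intervals[of "f ` {..n}"]) (use fbox in auto)
  define F where "F = interior ` {K\<in>P. interior K \<noteq> {}}"
  have fin: "finite P" using P by auto
  show ?thesis
  proof
    show "box_packing F" unfolding box_packing_def
    proof (intro conjI ballI)
      show "finite F" unfolding F_def using fin by auto
      show "disjoint F" unfolding F_def disjoint_def
      proof (intro ballI impI)
        fix X Y
        assume "X \<in> interior ` {K \<in> P. interior K \<noteq> {}}" "Y \<in> interior ` {K \<in> P. interior K \<noteq> {}}"
          and ne: "X \<noteq> Y"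
        then obtain K L where KL: "K \<in> P" "L \<in> P" "X = interior K" "Y = interior L" by blast
        then show "X \<inter> Y = {}" using division_ofD(5)[OF P KL(1,2)] ne by blast
      qed
      fix K assume "K \<in> F"
      then obtain L where L: "L \<in> P" "K = interior L" "K \<noteq> {}" by (auto simp: F_def)
      then show "K \<noteq> {}" by simp
      show "\<exists>a b. K = box a b" using division_ofD(4)[OF P L(1)] L(2) interior_cbox by metis
    qed
    have "A n \<subseteq> S" using UA by blast
    then show "\<Union>F \<subseteq> S" using division_ofD(2)[OF P] interior_subset unfolding F_def by blast
    have mP: "K \<in> lmeasurable" "negligible (frontier K)" if "K \<in> P" for K
      using division_ofD(4)[OF P that] by (auto intro: negligible_convex_frontier convex_box)
    have "negligible (A n - \<Union>F)"
    proof (rule negligible_subset)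
      show "negligible (\<Union>(frontier ` P))" using fin mP by (intro negligible_Union) auto
      show "A n - \<Union>F \<subseteq> \<Union>(frontier ` P)"
      proof
        fix x assume x: "x \<in> A n - \<Union>F"
        then obtain K where K: "K \<in> P" "x \<in> K" using division_ofD(6)[OF P] by blast
        then have "x \<notin> interior K" using x unfolding F_def by blast
        then have "x \<in> frontier K" using K(2) closure_subset unfolding frontier_def by blast
        then show "x \<in> \<Union>(frontier ` P)" using K(1) by blast
      qed
    qed
    moreover have "\<Union>F \<subseteq> A n" using division_ofD(2)[OF P] interior_subset unfolding F_def by blast
    ultimately have "measure lebesgue (A n) = measure lebesgue (\<Union>F)"
      by (intro measure_negligible_symdiff[OF mA, symmetric]) (auto elim: negligible_subset)
    then show "v < measure lebesgue (\<Union>F)" using n by simp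
  qed
qed

lemma brunn_minkowski_open:
  fixes A B :: "'a::euclidean_space set"
  assumes A: "open A" "bounded A" and B: "open B" "bounded B" and a: "0 < a" and b: "0 < b"
    and FA: "a ^ DIM('a) * s \<le> measure lebesgue A"
    and GB: "b ^ DIM('a) * s \<le> measure lebesgue B"
  shows "(a + b) ^ DIM('a) * s \<le> measure lebesgue (A + B)"
proof (cases "0 < s")
  case False
  then have "(a + b) ^ DIM('a) * s \<le> 0" using a b by (intro mult_nonneg_nonpos) auto
  then show ?thesis by (rule order_trans[OF _ measure_nonneg])
next
  case True
  have AB: "A + B \<in> lmeasurable" using A B by (intro lmeasurable_open bounded_set_plus open_set_plus)
  have "(a + b) ^ DIM('a) * s' \<le> measure lebesgue (A + B)" if s': "0 < s'" "s' < s" for s'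
  proof -
    have *: "x ^ DIM('a) * s' < m" if "0 < x" "x ^ DIM('a) * s \<le> m" for x m :: real
      by (rule less_le_trans[OF mult_strict_left_mono[OF s'(2)] that(2)]) (simp add: that(1))
    obtain F where F: "box_packing F" "\<Union>F \<subseteq> A" "a ^ DIM('a) * s' < measure lebesgue (\<Union>F)"
      by (rule open_inner_box_packing[OF A(1) lmeasurable_open[OF A(2,1)] *[OF a FA]])
    obtain G where G: "box_packing G" "\<Union>G \<subseteq> B" "b ^ DIM('a) * s' < measure lebesgue (\<Union>G)"
      by (rule open_inner_box_packing[OF B(1) lmeasurable_open[OF B(2,1)] *[OF b GB]])
    have "0 < a ^ DIM('a) * s'" "0 < b ^ DIM('a) * s'" using a b s' by auto
    then have "0 < measure lebesgue (\<Union>F)" "0 < measure lebesgue (\<Union>G)"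
      using F(3) G(3) by linarith+
    then have ne: "F \<noteq> {}" "G \<noteq> {}" by (metis Union_empty measure_empty less_irrefl)+
    have "(a + b) ^ DIM('a) * s' \<le> measure lebesgue (\<Union>F + \<Union>G)"
      by (rule brunn_minkowski_packing[OF F(1) ne(1) G(1) ne(2) a b s'(1) less_imp_le[OF F(3)] less_imp_le[OF G(3)]])
    also have "\<dots> \<le> measure lebesgue (A + B)"
    proof (rule measure_mono_fmeasurable[OF set_plus_mono2[OF F(2) G(2)] _ AB])
      show "\<Union> F + \<Union> G \<in> sets lebesgue"
        by (intro fmeasurableD box_packing_plus_lmeasurable F G)
    qed
    finally show ?thesis .
  qed
  then have "s' * (a + b) ^ DIM('a) \<le> measure lebesgue (A + B)" if "0 < s'" "s' < s" for s'
    using that by (simp add: mult.commute)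
  then have "s' \<le> measure lebesgue (A + B) / (a + b) ^ DIM('a)" if "0 < s'" "s' < s" for s'
    using that a b by (simp only: pos_le_divide_eq[OF zero_less_power[OF add_pos_pos]])
  then have "s \<le> measure lebesgue (A + B) / (a + b) ^ DIM('a)"
    by (rule dense_le_bounded[OF True])
  then show ?thesis using a b by (simp add: pos_le_divide_eq mult.commute)
qed

lemma brunn_minkowski_convex:
  fixes A B :: "'a::euclidean_space set"
  assumes A: "compact A" "convex A" and B: "compact B" "convex B" and a: "0 < a" and b: "0 < b"
    and FA: "a ^ DIM('a) * s \<le> measure lebesgue A"
    and GB: "b ^ DIM('a) * s \<le> measure lebesgue B"
  shows "(a + b) ^ DIM('a) * s \<le> measure lebesgue (A + B)"
proof -
  have int: "measure lebesgue (interior C) = measure lebesgue C" if "compact C" "convex C" for C :: "'a set"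
  proof (rule measure_negligible_symdiff)
    show "C \<in> lmeasurable" using that by (simp add: lmeasurable_compact)
    show "negligible (C - interior C \<union> (interior C - C))"
      by (rule negligible_subset[OF negligible_convex_frontier[OF that(2)]])
        (use interior_subset closure_subset in \<open>auto simp: frontier_def\<close>)
  qed
  have "(a + b) ^ DIM('a) * s \<le> measure lebesgue (interior A + interior B)"
  proof (rule brunn_minkowski_open[OF _ _ _ _ a b])
    show "a ^ DIM('a) * s \<le> measure lebesgue (interior A)" unfolding int[OF A] by (rule FA)
    show "b ^ DIM('a) * s \<le> measure lebesgue (interior B)" unfolding int[OF B] by (rule GB)
  qed (use A B in \<open>auto simp: bounded_interior compact_imp_bounded\<close>)
  also have "\<dots> \<le> measure lebesgue (A + B)"
  proof (rule measure_mono_fmeasurable)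
    show "interior A + interior B \<subseteq> A + B" by (intro set_plus_mono2 interior_subset)
    show "interior A + interior B \<in> sets lebesgue"
      using A B by (intro fmeasurableD lmeasurable_open bounded_set_plus open_set_plus)
        (auto simp: bounded_interior compact_imp_bounded)
    have "A + B = {x + y |x y. x \<in> A \<and> y \<in> B}" by (auto simp: set_plus_def)
    then show "A + B \<in> lmeasurable" using compact_sums[OF A(1) B(1)] by (simp only: lmeasurable_compact)
  qed
  finally show ?thesis .
qed

text \<open>With weights of sum 1 this says that a Minkowski mean of convex bodies has at least the smallest
  of their volumes, which is how it is used.\<close>
lemma brunn_minkowski_sum:
  fixes K :: "'i \<Rightarrow> 'a::euclidean_space set" and \<theta> :: "'i \<Rightarrow> real"
  assumes "finite I" "I \<noteq> {}"
    and "\<And>i. i \<in> I \<Longrightarrow> compact (K i) \<and> convex (K i) \<and> 0 < \<theta> i \<and> s \<le> measure lebesgue (K i)"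
    and "M = {\<Sum>i\<in>I. \<theta> i *\<^sub>R x i |x. \<forall>i\<in>I. x i \<in> K i}"
  shows "compact M \<and> convex M \<and> (\<Sum>i\<in>I. \<theta> i) ^ DIM('a) * s \<le> measure lebesgue M"
  using assms
proof (induction I arbitrary: M rule: finite_ne_induct)
  have scale: "compact ((*\<^sub>R) t ` C) \<and> convex ((*\<^sub>R) t ` C) \<and> t ^ DIM('a) * s \<le> measure lebesgue ((*\<^sub>R) t ` C)"
    if "compact C" "convex C" "0 < t" "s \<le> measure lebesgue C" for t and C :: "'a set"
    using that measure_lebesgue_affine[of t 0 C]
    by (auto simp: compact_scaling convex_scaling)
  {
    case (singleton i)
    have "M = (*\<^sub>R) (\<theta> i) ` K i" unfolding singleton by auto
    then show ?case using scale singleton(1) by simp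
  next
    case (insert i I)
    define N where "N = {\<Sum>i\<in>I. \<theta> i *\<^sub>R x i |x. \<forall>i\<in>I. x i \<in> K i}"
    have N: "compact N" "convex N" "(\<Sum>i\<in>I. \<theta> i) ^ DIM('a) * s \<le> measure lebesgue N"
      using insert.IH[OF _ N_def] insert.prems(1) by simp_all
    have K: "compact ((*\<^sub>R) (\<theta> i) ` K i)" "convex ((*\<^sub>R) (\<theta> i) ` K i)"
      "\<theta> i ^ DIM('a) * s \<le> measure lebesgue ((*\<^sub>R) (\<theta> i) ` K i)" "0 < \<theta> i"
      using scale insert.prems(1) by simp_all
    have M: "M = (*\<^sub>R) (\<theta> i) ` K i + N"
    proof (intro equalityI subsetI)
      fix y assume "y \<in> M"
      then obtain x where x: "\<forall>j\<in>insert i I. x j \<in> K j" "y = (\<Sum>j\<in>insert i I. \<theta> j *\<^sub>R x j)"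
        unfolding insert.prems(2) by blast
      then have "y = \<theta> i *\<^sub>R x i + (\<Sum>j\<in>I. \<theta> j *\<^sub>R x j)" using insert.hyps by simp
      moreover have "(\<Sum>j\<in>I. \<theta> j *\<^sub>R x j) \<in> N" using x N_def by blast
      moreover have "\<theta> i *\<^sub>R x i \<in> (*\<^sub>R) (\<theta> i) ` K i" using x(1) by (intro imageI) simp
      ultimately show "y \<in> (*\<^sub>R) (\<theta> i) ` K i + N" by (metis set_plus_intro)
    next
      fix y assume "y \<in> (*\<^sub>R) (\<theta> i) ` K i + N"
      then obtain z x where x: "z \<in> K i" "\<forall>j\<in>I. x j \<in> K j" "y = \<theta> i *\<^sub>R z + (\<Sum>j\<in>I. \<theta> j *\<^sub>R x j)"
        unfolding N_def by (auto elim!: set_plus_elim)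
      have "(\<Sum>j\<in>insert i I. \<theta> j *\<^sub>R (x(i := z)) j) = \<theta> i *\<^sub>R z + (\<Sum>j\<in>I. \<theta> j *\<^sub>R (x(i := z)) j)"
        using insert.hyps by simp
      also have "(\<Sum>j\<in>I. \<theta> j *\<^sub>R (x(i := z)) j) = (\<Sum>j\<in>I. \<theta> j *\<^sub>R x j)"
        using insert.hyps by (intro sum.cong) auto
      finally have "y = (\<Sum>j\<in>insert i I. \<theta> j *\<^sub>R (x(i := z)) j)" using x by simp
      moreover have "\<forall>j\<in>insert i I. (x(i := z)) j \<in> K j" using x by simp
      ultimately show "y \<in> M" unfolding insert.prems(2) by blast
    qed
    have "compact M"
    proof -
      have "M = {x + y |x y. x \<in> (*\<^sub>R) (\<theta> i) ` K i \<and> y \<in> N}" unfolding M set_plus_def by blast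
      then show ?thesis using compact_sums[OF K(1) N(1)] by (simp only:)
    qed
    moreover have "convex M" unfolding M by (rule convex_set_plus[OF K(2) N(2)])
    moreover have "(\<theta> i + (\<Sum>i\<in>I. \<theta> i)) ^ DIM('a) * s \<le> measure lebesgue M"
      unfolding M using insert.hyps insert.prems(1)
      by (intro brunn_minkowski_convex K N sum_pos) auto
    ultimately show ?case using insert.hyps by simp
  }
qed

section \<open>Lenses and caps of the ball\<close>

text \<open>The erosion of the unit ball by the segment from \<^term>\<open>- w *\<^sub>R u\<close> to \<^term>\<open>w *\<^sub>R u\<close>.\<close>
definition lens :: "real \<Rightarrow> 'a::euclidean_space \<Rightarrow> 'a set" where
  "lens w u = {x. norm (x + w *\<^sub>R u) \<le> 1 \<and> norm (x - w *\<^sub>R u) \<le> 1}"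

lemma compact_lens: "compact (lens w u)" and convex_lens: "convex (lens w u)"
proof -
  have "lens w u = cball (- (w *\<^sub>R u)) 1 \<inter> cball (w *\<^sub>R u) 1"
  proof (intro set_eqI)
    fix x
    have "dist (- (w *\<^sub>R u)) x = norm (x + w *\<^sub>R u)" "dist (w *\<^sub>R u) x = norm (x - w *\<^sub>R u)"
      by (simp_all add: dist_norm norm_minus_commute[of _ x] add.commute)
    then show "x \<in> lens w u \<longleftrightarrow> x \<in> cball (- (w *\<^sub>R u)) 1 \<inter> cball (w *\<^sub>R u) 1" by (simp add: lens_def)
  qed
  then show "compact (lens w u)" "convex (lens w u)" by (auto intro: convex_Int compact_Int)
qed

text \<open>The pieces may overlap. The hypothesis says that points of the translates come from a single
  point of the union, so no volume is lost when the pieces are made disjoint and moved.\<close>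
lemma measure_pieces_le_translates:
  fixes X :: "'i \<Rightarrow> 'a::euclidean_space set"
  assumes "finite I" and X: "\<And>i. i \<in> I \<Longrightarrow> X i \<in> lmeasurable"
    and inj: "\<And>i j x y. i \<in> I \<Longrightarrow> j \<in> I \<Longrightarrow> x \<in> X i \<Longrightarrow> y \<in> X j \<Longrightarrow> z i + x = z j + y \<Longrightarrow> x = y"
  shows "measure lebesgue (\<Union>i\<in>I. X i) \<le> measure lebesgue (\<Union>i\<in>I. (+) (z i) ` X i)"
  using assms
proof (induction I rule: finite_induct)
  case empty
  then show ?case by simp
next
  case (insert i I)
  let ?A = "\<Union>j\<in>I. X j" and ?T = "\<Union>j\<in>I. (+) (z j) ` X j"
  have A: "?A \<in> lmeasurable" and T: "?T \<in> lmeasurable"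
    using insert.hyps(1) insert.prems(1) by (auto intro!: fmeasurable.finite_UN measurable_translation)
  have Xi: "X i \<in> lmeasurable" using insert.prems(1) by simp
  have D: "X i - ?A \<in> lmeasurable" using Xi A by (rule fmeasurable.Diff)
  have disj: "(+) (z i) ` (X i - ?A) \<inter> ?T = {}"
    using insert.prems(2) by (auto; blast)
  have IH: "measure lebesgue ?A \<le> measure lebesgue ?T"
  proof (rule insert.IH)
    fix j k x y assume jk: "j \<in> I" "k \<in> I" and *: "x \<in> X j" "y \<in> X k" "z j + x = z k + y"
    show "x = y" by (rule insert.prems(2)[OF _ _ *]) (simp_all add: jk)
  qed (use insert.prems(1) in auto)
  have "measure lebesgue (\<Union>j\<in>insert i I. X j) = measure lebesgue ((X i - ?A) \<union> ?A)"
    by (intro arg_cong[where f = "measure lebesgue"]) auto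
  also have "\<dots> = measure lebesgue (X i - ?A) + measure lebesgue ?A"
  proof -
    have "(X i - ?A) \<inter> ?A = {}" by blast
    then show ?thesis by (rule measure_Un_disjoint[OF D A])
  qed
  also have "\<dots> \<le> measure lebesgue ((+) (z i) ` (X i - ?A)) + measure lebesgue ?T"
    using IH by (intro add_mono) (simp_all add: measure_translation)
  also have "\<dots> = measure lebesgue ((+) (z i) ` (X i - ?A) \<union> ?T)"
    by (rule measure_Un_disjoint[OF measurable_translation[OF D] T disj, symmetric])
  also have "\<dots> \<le> measure lebesgue (\<Union>j\<in>insert i I. (+) (z j) ` X j)"
  proof (rule measure_mono_fmeasurable)
    show "(+) (z i) ` (X i - ?A) \<union> ?T \<subseteq> (\<Union>j\<in>insert i I. (+) (z j) ` X j)" by auto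
    show "(+) (z i) ` (X i - ?A) \<union> ?T \<in> sets lebesgue"
      by (intro fmeasurableD fmeasurable.Un measurable_translation D T)
    show "(\<Union>j\<in>insert i I. (+) (z j) ` X j) \<in> lmeasurable"
      using insert.hyps(1) insert.prems(1) by (intro fmeasurable.finite_UN measurable_translation) auto
  qed
  finally show ?case .
qed

text \<open>The two caps left by the central plank are pushed together by \<^term>\<open>w\<close> each along \<^term>\<open>u\<close>;
  they land in the lens on different sides of the hyperplane through the origin.\<close>
lemma measure_caps_le_lens:
  fixes u :: "'a::euclidean_space"
  assumes u: "norm u = 1" and w: "0 < w"
  shows "measure lebesgue (cball 0 1 - closed_strip u (- w) w) \<le> measure lebesgue (lens w u)"
proof -
  \<comment> \<open>\<^term>\<open>b\<close> tells the upper cap from the lower one\<close>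
  define X where "X b = (if b then {x. w < x \<bullet> u} else {x. x \<bullet> u < - w}) \<inter> cball (0::'a) 1" for b
  define z where "z b = (if b then - (w *\<^sub>R u) else w *\<^sub>R u)" for b
  have uu: "u \<bullet> u = 1" using u by (simp add: dot_square_norm)
  have hs: "{x. w < x \<bullet> u} = {x. u \<bullet> x > w}" "{x. x \<bullet> u < - w} = {x. u \<bullet> x < - w}"
    by (auto simp: inner_commute)
  have X: "X b \<in> lmeasurable" for b
  proof -
    have "cball 0 1 \<inter> {x. u \<bullet> x > w} \<in> lmeasurable" "cball 0 1 \<inter> {x. u \<bullet> x < - w} \<in> lmeasurable"
      by (intro lmeasurable_Int_open lmeasurable_cball open_halfspace_gt open_halfspace_lt)+
    then show ?thesis by (simp add: X_def hs Int_commute)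
  qed
  have sep: "False" if "w < x \<bullet> u" "y \<bullet> u < - w" "- (w *\<^sub>R u) + x = w *\<^sub>R u + y" for x y
  proof -
    have "(- (w *\<^sub>R u) + x) \<bullet> u = (w *\<^sub>R u + y) \<bullet> u" using that by simp
    then show False using that by (simp add: inner_simps uu)
  qed
  have "cball 0 1 - closed_strip u (- w) w = (\<Union>b\<in>UNIV. X b)"
    by (auto simp: X_def closed_strip_def UNIV_bool)
  then have "measure lebesgue (cball 0 1 - closed_strip u (- w) w) = measure lebesgue (\<Union>b\<in>UNIV. X b)"
    by simp
  also have "\<dots> \<le> measure lebesgue (\<Union>b\<in>UNIV. (+) (z b) ` X b)"
  proof (rule measure_pieces_le_translates[OF _ X])
    fix b c x y assume *: "x \<in> X b" "y \<in> X c" "z b + x = z c + y"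
    show "x = y"
    proof (cases "b = c")
      case True
      then show ?thesis using * by simp
    next
      case False
      then show ?thesis using * sep[of x y] sep[of y x] by (auto simp: X_def z_def split: if_splits)
    qed
  qed simp
  also have "\<dots> \<le> measure lebesgue (lens w u)"
  proof (rule measure_mono_fmeasurable)
    have sq: "(norm (x + c *\<^sub>R u))\<^sup>2 = (norm x)\<^sup>2 + 2 * c * (x \<bullet> u) + c\<^sup>2" for x c
      unfolding power2_norm_eq_inner by (simp add: inner_simps uu inner_commute power2_eq_square algebra_simps)
    have *: "norm (x + c *\<^sub>R u) \<le> 1" if "norm x \<le> 1" "c * (2 * (x \<bullet> u) + c) \<le> 0" for x c
    proof -
      have "(norm (x + c *\<^sub>R u))\<^sup>2 \<le> (norm x)\<^sup>2"
        unfolding sq using that(2) by (simp add: algebra_simps power2_eq_square)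
      then have "norm (x + c *\<^sub>R u) \<le> norm x" using norm_ge_zero power2_le_imp_le by blast
      then show ?thesis using that(1) by simp
    qed
    have 1: "- (w *\<^sub>R u) + x \<in> lens w u" if "norm x \<le> 1" "w < x \<bullet> u" for x
    proof -
      have eq: "- (w *\<^sub>R u) + x - w *\<^sub>R u = x + (- 2 * w) *\<^sub>R u"
        by (simp add: algebra_simps scaleR_2 flip: scaleR_scaleR)
      have "norm (- (w *\<^sub>R u) + x - w *\<^sub>R u) \<le> 1"
        unfolding eq using that w by (intro *) (auto simp: mult_nonpos_nonneg)
      then show ?thesis using that(1) by (simp add: lens_def)
    qed
    have 2: "w *\<^sub>R u + x \<in> lens w u" if "norm x \<le> 1" "x \<bullet> u < - w" for x
    proof -
      have eq: "w *\<^sub>R u + x + w *\<^sub>R u = x + (2 * w) *\<^sub>R u"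
        by (simp add: algebra_simps scaleR_2 flip: scaleR_scaleR)
      have "norm (w *\<^sub>R u + x + w *\<^sub>R u) \<le> 1"
        unfolding eq using that w by (intro *) (auto simp: mult_nonneg_nonpos)
      then show ?thesis using that(1) by (simp add: lens_def)
    qed
    show "(\<Union>b\<in>UNIV. (+) (z b) ` X b) \<subseteq> lens w u"
      using 1 2 by (auto simp: X_def z_def UNIV_bool)
    show "(\<Union>b\<in>UNIV. (+) (z b) ` X b) \<in> sets lebesgue"
      by (intro sets.finite_UN fmeasurableD measurable_translation X) auto
    show "lens w u \<in> lmeasurable" by (intro lmeasurable_compact compact_lens)
  qed
  finally show ?thesis .
qed

lemma power2_norm_diff:
  fixes a b :: "'a::real_inner"
  shows "(norm (a - b))\<^sup>2 = (norm a)\<^sup>2 - 2 * (a \<bullet> b) + (norm b)\<^sup>2"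
  unfolding power2_norm_eq_inner by (simp add: inner_diff_left inner_diff_right inner_commute)

section \<open>Bang's map and the eroded ball\<close>

text \<open>Finitely many planks with unit normals \<^term>\<open>u i\<close>, half-widths \<^term>\<open>h i\<close> and central hyperplanes at
  the signed distances \<^term>\<open>m i\<close> from the origin.\<close>
locale plank_system =
  fixes I :: "'i set" and u :: "'i \<Rightarrow> 'a::euclidean_space" and h m :: "'i \<Rightarrow> real"
  assumes finite_I: "finite I"
    and norm_u: "\<And>i. i \<in> I \<Longrightarrow> norm (u i) = 1"
    and h_pos: "\<And>i. i \<in> I \<Longrightarrow> 0 < h i"
begin

definition signs :: "('i \<Rightarrow> real) set" where
  "signs = I \<rightarrow>\<^sub>E {-1, 1}"

text \<open>These points contain all vertices of the zonotope generated by the segments from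
  \<^term>\<open>- h i *\<^sub>R u i\<close> to \<^term>\<open>h i *\<^sub>R u i\<close>.\<close>
definition vertex :: "('i \<Rightarrow> real) \<Rightarrow> 'a" where
  "vertex \<epsilon> = (\<Sum>i\<in>I. (\<epsilon> i * h i) *\<^sub>R u i)"

text \<open>The quantity that Bang's argument maximises over the choice of signs.\<close>
definition potential :: "'a \<Rightarrow> ('i \<Rightarrow> real) \<Rightarrow> real" where
  "potential x \<epsilon> = (norm (x + vertex \<epsilon>))\<^sup>2 / 2 - (\<Sum>i\<in>I. \<epsilon> i * h i * m i)"

text \<open>The points \<^term>\<open>x\<close> for which the zonotope translated by \<^term>\<open>x\<close> stays inside the unit ball; by convexity
  it is enough to ask this of the sign vectors.\<close>
definition erosion :: "'a set" where
  "erosion = {x. \<forall>\<epsilon>\<in>signs. norm (x + vertex \<epsilon>) \<le> 1}"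

definition piece :: "('i \<Rightarrow> real) \<Rightarrow> 'a set" where
  "piece \<epsilon> = {x\<in>erosion. \<forall>\<delta>\<in>signs. potential x \<delta> \<le> potential x \<epsilon>}"

text \<open>Points of the erosion are moved by a sign vector of largest potential. Ties are not broken:
  a point is moved by every maximiser, which makes the pieces closed and the image compact.\<close>
definition bang_image :: "'a set" where
  "bang_image = (\<Union>\<epsilon>\<in>signs. (+) (vertex \<epsilon>) ` piece \<epsilon>)"

lemma finite_signs: "finite signs"
  unfolding signs_def using finite_I by (intro finite_PiE) auto

lemma signs_cases: "\<epsilon> \<in> signs \<Longrightarrow> i \<in> I \<Longrightarrow> \<epsilon> i = 1 \<or> \<epsilon> i = - 1"
  unfolding signs_def by (auto dest: PiE_mem)

lemma restrict_signs: "(\<And>i. i \<in> I \<Longrightarrow> f i \<in> {-1, 1}) \<Longrightarrow> restrict f I \<in> signs"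
  unfolding signs_def by auto

lemma signs_nonempty: "signs \<noteq> {}"
  using restrict_signs[of "\<lambda>_. 1"] by auto

lemma flip_signs:
  assumes "\<epsilon> \<in> signs" "i \<in> I" shows "\<epsilon>(i := - \<epsilon> i) \<in> signs"
  using assms signs_cases[OF assms] unfolding signs_def by (auto simp: PiE_iff extensional_def)

lemma vertex_flip:
  assumes "i \<in> I"
  shows "vertex (\<epsilon>(i := - \<epsilon> i)) = vertex \<epsilon> - (2 * \<epsilon> i * h i) *\<^sub>R u i"
proof -
  have "(\<Sum>j\<in>I - {i}. ((\<epsilon>(i := - \<epsilon> i)) j * h j) *\<^sub>R u j) = (\<Sum>j\<in>I - {i}. (\<epsilon> j * h j) *\<^sub>R u j)"
    by (rule sum.cong) auto
  moreover have "(2 * \<epsilon> i * h i) *\<^sub>R u i = (\<epsilon> i * h i) *\<^sub>R u i + (\<epsilon> i * h i) *\<^sub>R u i"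
    by (simp add: scaleR_add_left[symmetric])
  ultimately show ?thesis using assms finite_I by (simp add: vertex_def sum.remove[of I i])
qed

lemma norm_vertex_le:
  assumes "\<epsilon> \<in> signs" shows "norm (vertex \<epsilon>) \<le> (\<Sum>i\<in>I. h i)"
  unfolding vertex_def
proof (rule order_trans[OF norm_sum], rule sum_mono)
  fix i assume i: "i \<in> I"
  show "norm ((\<epsilon> i * h i) *\<^sub>R u i) \<le> h i"
    using signs_cases[OF assms i] norm_u[OF i] h_pos[OF i] by auto
qed

text \<open>Flipping one sign moves the point by \<^term>\<open>2 * h i\<close> along the normal of one plank, so an upper bound
  for the norm after the flip is a lower bound for the component along that normal.\<close>
lemma norm_flip_le_imp:
  assumes \<epsilon>: "\<epsilon> \<in> signs" and i: "i \<in> I"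
    and le: "(norm (x + vertex (\<epsilon>(i := - \<epsilon> i))))\<^sup>2 \<le> (norm (x + vertex \<epsilon>))\<^sup>2 + 4 * h i * c"
  shows "h i \<le> \<epsilon> i * ((x + vertex \<epsilon>) \<bullet> u i) + c"
proof -
  let ?y = "x + vertex \<epsilon>"
  have uu: "u i \<bullet> u i = 1" using norm_u[OF i] by (simp add: dot_square_norm)
  have e2: "\<epsilon> i * \<epsilon> i = 1" using signs_cases[OF \<epsilon> i] by auto
  have "(norm (x + vertex (\<epsilon>(i := - \<epsilon> i))))\<^sup>2 = (norm (?y - (2 * \<epsilon> i * h i) *\<^sub>R u i))\<^sup>2"
    by (simp add: vertex_flip[OF i] algebra_simps)
  also have "\<dots> = (norm ?y)\<^sup>2 - 4 * h i * (\<epsilon> i * (?y \<bullet> u i)) + 4 * h i * h i * (\<epsilon> i * \<epsilon> i)"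
    unfolding power2_norm_eq_inner by (simp add: inner_diff_left inner_diff_right uu inner_commute algebra_simps)
  finally have "4 * h i * h i \<le> 4 * h i * (\<epsilon> i * (?y \<bullet> u i) + c)"
    using le by (simp add: e2 distrib_left)
  then show ?thesis using h_pos[OF i] by simp
qed

text \<open>Bang's lemma: if no single flip raises the potential, the moved point avoids every open plank.\<close>
lemma bang_avoids_strip:
  assumes \<epsilon>: "\<epsilon> \<in> signs" and x: "x \<in> piece \<epsilon>" and i: "i \<in> I"
  shows "x + vertex \<epsilon> \<notin> open_strip (u i) (m i - h i) (m i + h i)"
proof -
  have "(\<Sum>j\<in>I - {i}. (\<epsilon>(i := - \<epsilon> i)) j * h j * m j) = (\<Sum>j\<in>I - {i}. \<epsilon> j * h j * m j)"
    by (rule sum.cong) auto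
  then have s: "(\<Sum>j\<in>I. (\<epsilon>(i := - \<epsilon> i)) j * h j * m j) = (\<Sum>j\<in>I. \<epsilon> j * h j * m j) - 2 * \<epsilon> i * h i * m i"
    using i finite_I by (simp add: sum.remove[of I i])
  have "potential x (\<epsilon>(i := - \<epsilon> i)) \<le> potential x \<epsilon>"
    using x flip_signs[OF \<epsilon> i] by (simp add: piece_def)
  then have "(norm (x + vertex (\<epsilon>(i := - \<epsilon> i))))\<^sup>2 \<le> (norm (x + vertex \<epsilon>))\<^sup>2 + 4 * h i * (- (\<epsilon> i * m i))"
    unfolding potential_def s by (simp add: algebra_simps)
  then have "h i \<le> \<epsilon> i * ((x + vertex \<epsilon>) \<bullet> u i) + - (\<epsilon> i * m i)"
    by (rule norm_flip_le_imp[OF \<epsilon> i])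
  then show ?thesis using signs_cases[OF \<epsilon> i] by (auto simp: open_strip_def)
qed

text \<open>Up to a term depending on \<^term>\<open>x\<close> alone, the potential is affine in \<^term>\<open>x\<close> with gradient
  \<^term>\<open>vertex \<epsilon>\<close>. Hence its maximum over the signs is convex apart from that term, the displacement is
  a selection of the subgradient, and the map \<^term>\<open>x\<close> to \<^term>\<open>x + vertex \<epsilon>\<close> is strictly monotone.\<close>
lemma bang_injective:
  assumes \<epsilon>: "\<epsilon> \<in> signs" "x \<in> piece \<epsilon>" and \<delta>: "\<delta> \<in> signs" "y \<in> piece \<delta>"
    and eq: "vertex \<epsilon> + x = vertex \<delta> + y"
  shows "x = y"
proof -
  have "potential x \<delta> \<le> potential x \<epsilon>" "potential y \<epsilon> \<le> potential y \<delta>"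
    using \<epsilon> \<delta> by (auto simp: piece_def)
  then have "potential x \<delta> + potential y \<epsilon> \<le> potential x \<epsilon> + potential y \<delta>" by simp
  then have "0 \<le> (x - y) \<bullet> (vertex \<epsilon> - vertex \<delta>)"
    unfolding potential_def power2_norm_eq_inner by (simp add: inner_simps inner_commute field_simps)
  also have "vertex \<epsilon> - vertex \<delta> = - (x - y)" using eq by (simp add: algebra_simps)
  finally have "(x - y) \<bullet> (x - y) \<le> 0" by (simp add: inner_minus_right del: minus_diff_eq)
  then show ?thesis by (metis inner_gt_zero_iff not_le right_minus_eq)
qed

lemma erosion_eq: "erosion = (\<Inter>\<epsilon>\<in>signs. cball (- vertex \<epsilon>) 1)"
  by (auto simp: erosion_def dist_norm norm_minus_commute add.commute)

lemma compact_erosion: "compact erosion"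
proof -
  obtain \<epsilon> where \<epsilon>: "\<epsilon> \<in> signs" using signs_nonempty by blast
  have "closed erosion" unfolding erosion_eq by (intro closed_INT ballI closed_cball)
  moreover have "bounded erosion"
    unfolding erosion_eq by (rule bounded_subset[OF bounded_cball[of "- vertex \<epsilon>" 1]]) (use \<epsilon> in auto)
  ultimately show ?thesis by (simp add: compact_eq_bounded_closed)
qed

lemma convex_erosion: "convex erosion"
  unfolding erosion_eq by (intro convex_INT convex_cball)

lemma compact_piece: "compact (piece \<epsilon>)"
proof -
  have "closed {x. potential x \<delta> \<le> potential x \<epsilon>}" for \<delta>
    unfolding potential_def by (intro closed_Collect_le continuous_intros) auto
  then have "closed (\<Inter>\<delta>\<in>signs. {x. potential x \<delta> \<le> potential x \<epsilon>})" by blast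
  moreover have "piece \<epsilon> = erosion \<inter> (\<Inter>\<delta>\<in>signs. {x. potential x \<delta> \<le> potential x \<epsilon>})"
    by (auto simp: piece_def)
  ultimately show ?thesis using compact_erosion by (simp add: compact_Int_closed)
qed

lemma compact_bang_image: "compact bang_image"
  unfolding bang_image_def by (intro compact_UN finite_signs compact_translation compact_piece)

lemma bang_image_subset: "bang_image \<subseteq> cball 0 1 - (\<Union>i\<in>I. open_strip (u i) (m i - h i) (m i + h i))"
proof
  fix y assume "y \<in> bang_image"
  then obtain \<epsilon> x where *: "\<epsilon> \<in> signs" "x \<in> piece \<epsilon>" "y = x + vertex \<epsilon>"
    by (auto simp: bang_image_def add.commute)
  then have "norm y \<le> 1" by (auto simp: piece_def erosion_def)
  then show "y \<in> cball 0 1 - (\<Union>i\<in>I. open_strip (u i) (m i - h i) (m i + h i))"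
    using bang_avoids_strip[OF *(1,2)] *(3) by simp
qed

text \<open>The volume form of Bang's lemma: the map is injective and piecewise a translation.\<close>
lemma measure_erosion_le: "measure lebesgue erosion \<le> measure lebesgue bang_image"
proof -
  have "erosion = (\<Union>\<epsilon>\<in>signs. piece \<epsilon>)"
  proof (intro equalityI subsetI)
    fix x assume x: "x \<in> erosion"
    have "Max (potential x ` signs) \<in> potential x ` signs"
      using finite_signs signs_nonempty by (intro Max_in) auto
    then obtain \<epsilon> where \<epsilon>: "\<epsilon> \<in> signs" "Max (potential x ` signs) = potential x \<epsilon>" by blast
    have "potential x \<delta> \<le> potential x \<epsilon>" if "\<delta> \<in> signs" for \<delta>
      unfolding \<epsilon>(2)[symmetric] using that finite_signs by (intro Max_ge) auto
    then show "x \<in> (\<Union>\<epsilon>\<in>signs. piece \<epsilon>)" using x \<epsilon>(1) by (auto simp: piece_def)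
  qed (auto simp: piece_def)
  moreover have "measure lebesgue (\<Union>\<epsilon>\<in>signs. piece \<epsilon>) \<le> measure lebesgue bang_image"
    unfolding bang_image_def
  proof (rule measure_pieces_le_translates[OF finite_signs])
    show "piece \<epsilon> \<in> lmeasurable" for \<epsilon> by (rule lmeasurable_compact[OF compact_piece])
    show "x = y" if "\<epsilon> \<in> signs" "\<delta> \<in> signs" "x \<in> piece \<epsilon>" "y \<in> piece \<delta>"
      "vertex \<epsilon> + x = vertex \<delta> + y" for \<epsilon> \<delta> x y
      using bang_injective[OF that(1,3,2,4,5)] .
  qed
  ultimately show ?thesis by simp
qed

section \<open>Comparison of the eroded ball with lenses\<close>

text \<open>The zonotope is the mean, with weights \<^term>\<open>h i / sum h I\<close>, of the segments of half-length \<^term>\<open>sum h I\<close>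
  in the directions \<^term>\<open>u i\<close>. The set defined here is the mean of the erosions by these segments.\<close>
definition lens_mean :: "'a set" where
  "lens_mean = {\<Sum>i\<in>I. (h i / sum h I) *\<^sub>R x i |x. \<forall>i\<in>I. x i \<in> lens (sum h I) (u i)}"

text \<open>Erosion of a convex body is superadditive in this sense: the \<^term>\<open>i\<close>-th summand leaves room for the
  \<^term>\<open>i\<close>-th segment, so the mean leaves room for the mean of the segments.\<close>
lemma lens_mean_subset:
  assumes ne: "I \<noteq> {}"
  shows "lens_mean \<subseteq> erosion"
proof
  fix p assume "p \<in> lens_mean"
  then obtain x where x: "\<And>i. i \<in> I \<Longrightarrow> x i \<in> lens (sum h I) (u i)" and p: "p = (\<Sum>i\<in>I. (h i / sum h I) *\<^sub>R x i)"
    unfolding lens_mean_def by blast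
  have w: "0 < sum h I" using finite_I ne h_pos by (intro sum_pos) auto
  show "p \<in> erosion" unfolding erosion_def
  proof (intro CollectI ballI)
    fix \<epsilon> assume \<epsilon>: "\<epsilon> \<in> signs"
    have "p + vertex \<epsilon> = (\<Sum>i\<in>I. (h i / sum h I) *\<^sub>R (x i + (\<epsilon> i * sum h I) *\<^sub>R u i))"
      unfolding p vertex_def sum.distrib[symmetric] using w by (intro sum.cong) (auto simp: scaleR_add_right)
    also have "norm \<dots> \<le> (\<Sum>i\<in>I. h i / sum h I)"
    proof (rule order_trans[OF norm_sum], rule sum_mono)
      fix i assume i: "i \<in> I"
      have "norm (x i + (\<epsilon> i * sum h I) *\<^sub>R u i) \<le> 1"
        using x[OF i] signs_cases[OF \<epsilon> i] by (auto simp: lens_def)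
      then show "norm ((h i / sum h I) *\<^sub>R (x i + (\<epsilon> i * sum h I) *\<^sub>R u i)) \<le> h i / sum h I"
        using h_pos[OF i] w by (simp add: divide_right_mono mult_left_le)
    qed
    also have "\<dots> = 1" using w by (simp flip: sum_divide_distrib)
    finally show "norm (p + vertex \<epsilon>) \<le> 1" .
  qed
qed

lemma lens_mean_properties:
  assumes ne: "I \<noteq> {}" and s: "\<And>i. i \<in> I \<Longrightarrow> s \<le> measure lebesgue (lens (sum h I) (u i))"
  shows "compact lens_mean" "s \<le> measure lebesgue lens_mean"
proof -
  have w: "0 < sum h I" using finite_I ne h_pos by (intro sum_pos) auto
  have "compact lens_mean \<and> convex lens_mean \<and> (\<Sum>i\<in>I. h i / sum h I) ^ DIM('a) * s \<le> measure lebesgue lens_mean"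
    by (rule brunn_minkowski_sum[OF finite_I ne _ lens_mean_def])
      (use s h_pos w compact_lens convex_lens in auto)
  moreover have "(\<Sum>i\<in>I. h i / sum h I) = 1" using w by (simp flip: sum_divide_distrib)
  ultimately show "compact lens_mean" "s \<le> measure lebesgue lens_mean" by auto
qed

text \<open>The point of the unit sphere where a translated vertex touches is the mean of points \<^term>\<open>q i\<close> of
  the ball, so by strict convexity they all agree with it. That the opposite end of each segment
  also stays in the ball then bounds the component along \<^term>\<open>u i\<close>.\<close>
lemma erosion_touching_imp:
  assumes ne: "I \<noteq> {}" and p: "p \<in> lens_mean" and \<epsilon>: "\<epsilon> \<in> signs" and touch: "norm (p + vertex \<epsilon>) = 1"
    and i: "i \<in> I"
  shows "sum h I \<le> \<epsilon> i * ((p + vertex \<epsilon>) \<bullet> u i)"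
proof -
  let ?w = "sum h I"
  define \<xi> where "\<xi> = p + vertex \<epsilon>"
  have \<xi>: "norm \<xi> = 1" using touch by (simp add: \<xi>_def)
  have w: "0 < ?w" using finite_I ne h_pos by (intro sum_pos) auto
  obtain x where x: "\<And>i. i \<in> I \<Longrightarrow> x i \<in> lens ?w (u i)" and px: "p = (\<Sum>i\<in>I. (h i / ?w) *\<^sub>R x i)"
    using p unfolding lens_mean_def by blast
  \<comment> \<open>the end of the \<^term>\<open>i\<close>-th segment at \<^term>\<open>x i\<close> that the signs \<^term>\<open>\<epsilon>\<close> select\<close>
  define q where "q i = x i + (\<epsilon> i * ?w) *\<^sub>R u i" for i
  have q1: "norm (q i) \<le> 1" if "i \<in> I" for i
    using x[OF that] signs_cases[OF \<epsilon> that] by (auto simp: lens_def q_def)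
  have \<xi>q: "\<xi> = (\<Sum>i\<in>I. (h i / ?w) *\<^sub>R q i)"
    unfolding \<xi>_def px vertex_def sum.distrib[symmetric] q_def
    using w by (intro sum.cong) (auto simp: scaleR_add_right)
  have le: "\<xi> \<bullet> q i \<le> 1" if "i \<in> I" for i
    using norm_cauchy_schwarz[of \<xi> "q i"] q1[OF that] \<xi> by simp
  have "(\<Sum>i\<in>I. (h i / ?w) * (1 - \<xi> \<bullet> q i)) = (\<Sum>i\<in>I. h i / ?w) - \<xi> \<bullet> (\<Sum>i\<in>I. (h i / ?w) *\<^sub>R q i)"
    by (simp add: inner_sum_right sum_subtractf right_diff_distrib)
  also have "\<dots> = 0"
    unfolding \<xi>q[symmetric] using w \<xi> by (simp add: dot_square_norm flip: sum_divide_distrib)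
  finally have "(h i / ?w) * (1 - \<xi> \<bullet> q i) = 0"
    using finite_I le h_pos w i by (subst (asm) sum_nonneg_eq_0_iff) (auto simp: less_imp_le)
  then have 1: "\<xi> \<bullet> q i = 1" using h_pos[OF i] w by simp
  have "(norm (\<xi> - q i))\<^sup>2 = (norm \<xi>)\<^sup>2 - 2 * (\<xi> \<bullet> q i) + (norm (q i))\<^sup>2"
    by (rule power2_norm_diff)
  also have "\<dots> \<le> 0" using q1[OF i] \<xi> 1 by (simp add: power_le_one)
  finally have \<xi>i: "q i = \<xi>" by simp
  have uu: "u i \<bullet> u i = 1" using norm_u[OF i] by (simp add: dot_square_norm)
  have e2: "\<epsilon> i * \<epsilon> i = 1" using signs_cases[OF \<epsilon> i] by auto
  have "norm (x i - (\<epsilon> i * ?w) *\<^sub>R u i) \<le> 1"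
    using x[OF i] signs_cases[OF \<epsilon> i] by (auto simp: lens_def)
  moreover have "x i - (\<epsilon> i * ?w) *\<^sub>R u i = \<xi> - (2 * \<epsilon> i * ?w) *\<^sub>R u i"
    unfolding \<xi>i[symmetric] q_def by (simp add: algebra_simps scaleR_2 flip: scaleR_scaleR)
  ultimately have "(norm (\<xi> - (2 * \<epsilon> i * ?w) *\<^sub>R u i))\<^sup>2 \<le> 1" by (simp add: power_le_one)
  also have "(norm (\<xi> - (2 * \<epsilon> i * ?w) *\<^sub>R u i))\<^sup>2
      = (norm \<xi>)\<^sup>2 - 4 * ?w * (\<epsilon> i * (\<xi> \<bullet> u i)) + 4 * ?w * ?w * (\<epsilon> i * \<epsilon> i)"
    unfolding power2_norm_eq_inner by (simp add: inner_diff_left inner_diff_right uu inner_commute algebra_simps)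
  finally have "4 * ?w * ?w \<le> 4 * ?w * (\<epsilon> i * (\<xi> \<bullet> u i))" using \<xi> e2 by simp
  then show ?thesis using w by (simp add: \<xi>_def)
qed

lemma zero_in_interior_erosion:
  assumes w1: "sum h I < 1"
  shows "(0::'a) \<in> interior erosion"
proof (rule interiorI)
  show "open (ball (0::'a) (1 - sum h I))" "(0::'a) \<in> ball 0 (1 - sum h I)" using w1 by auto
  show "ball 0 (1 - sum h I) \<subseteq> erosion"
  proof
    fix x :: 'a assume "x \<in> ball 0 (1 - sum h I)"
    then have "norm x + sum h I < 1" by simp
    then have "norm (x + vertex \<epsilon>) \<le> 1" if "\<epsilon> \<in> signs" for \<epsilon>
      using norm_triangle_ineq[of x "vertex \<epsilon>"] norm_vertex_le[OF that] by linarith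
    then show "x \<in> erosion" unfolding erosion_def by blast
  qed
qed

text \<open>Equality forces parallel normals. A point of the boundary of the erosion is taken on a ray
  orthogonal to one normal \<^term>\<open>u k\<close>; this is where the dimension has to be at least 2. Some vertex touches
  the sphere there, and its component along \<^term>\<open>u k\<close> is at least the sum of all half-widths. A
  sum of vectors of lengths \<^term>\<open>h i\<close> reaches this only if all of them point in the same direction.\<close>
lemma parallel_if_erosion_eq:
  assumes ne: "I \<noteq> {}" and w1: "sum h I < 1" and eq: "erosion \<subseteq> lens_mean" and d: "2 \<le> DIM('a)"
  shows "\<exists>v. norm v = 1 \<and> (\<forall>i\<in>I. u i = v \<or> u i = - v)"
proof -
  let ?w = "sum h I"
  obtain k where k: "k \<in> I" using ne by blast
  obtain e where e: "e \<noteq> 0" "orthogonal (u k) e" using orthogonal_to_vector_exists[OF d] by blast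
  have int0: "(0::'a) \<in> interior erosion" by (rule zero_in_interior_erosion[OF w1])
  obtain t where t: "0 < t" "0 + t *\<^sub>R e \<in> frontier erosion"
    by (rule ray_to_frontier[OF compact_imp_bounded[OF compact_erosion] int0 e(1)])
  define p where "p = t *\<^sub>R e"
  have pf: "p \<in> frontier erosion" using t by (simp add: p_def)
  have pe: "p \<in> erosion" using pf frontier_subset_compact[OF compact_erosion] by blast
  have "\<exists>\<epsilon>\<in>signs. norm (p + vertex \<epsilon>) = 1"
  proof (rule ccontr)
    assume "\<not> ?thesis"
    then have "norm (p + vertex \<epsilon>) < 1" if "\<epsilon> \<in> signs" for \<epsilon>
      using pe that unfolding erosion_def by (simp add: order_le_less)
    then have mem: "p \<in> (\<Inter>\<epsilon>\<in>signs. {x. norm (x + vertex \<epsilon>) < 1})" by simp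
    have "open (\<Inter>\<epsilon>\<in>signs. {x. norm (x + vertex \<epsilon>) < 1})"
      using finite_signs by (intro open_INT ballI open_Collect_less continuous_intros)
    moreover have "(\<Inter>\<epsilon>\<in>signs. {x. norm (x + vertex \<epsilon>) < 1}) \<subseteq> erosion"
      by (auto simp: erosion_def less_imp_le)
    ultimately have "p \<in> interior erosion" using mem by (intro interiorI)
    then show False using pf by (simp add: frontier_def)
  qed
  then obtain \<epsilon> where \<epsilon>: "\<epsilon> \<in> signs" and touch: "norm (p + vertex \<epsilon>) = 1" by blast
  have "?w \<le> \<epsilon> k * ((p + vertex \<epsilon>) \<bullet> u k)"
    using erosion_touching_imp[OF ne _ \<epsilon> touch k] pe eq by blast
  also have "\<dots> = vertex \<epsilon> \<bullet> (\<epsilon> k *\<^sub>R u k)"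
    using e by (simp add: p_def orthogonal_def inner_simps inner_commute)
  finally have le: "?w \<le> vertex \<epsilon> \<bullet> (\<epsilon> k *\<^sub>R u k)" .
  define v where "v = \<epsilon> k *\<^sub>R u k"
  have v: "norm v = 1" using signs_cases[OF \<epsilon> k] norm_u[OF k] by (auto simp: v_def)
  have n1: "norm (\<epsilon> i *\<^sub>R u i) = 1" if "i \<in> I" for i
    using signs_cases[OF \<epsilon> that] norm_u[OF that] by auto
  have le1: "(\<epsilon> i *\<^sub>R u i) \<bullet> v \<le> 1" if "i \<in> I" for i
    using norm_cauchy_schwarz[of "\<epsilon> i *\<^sub>R u i" v] n1[OF that] v by simp
  have "(\<Sum>i\<in>I. h i * (1 - (\<epsilon> i *\<^sub>R u i) \<bullet> v)) = ?w - vertex \<epsilon> \<bullet> v"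
    by (simp add: vertex_def inner_sum_left sum_subtractf right_diff_distrib ac_simps)
  also have "\<dots> \<le> 0" using le by (simp add: v_def)
  finally have s0: "(\<Sum>i\<in>I. h i * (1 - (\<epsilon> i *\<^sub>R u i) \<bullet> v)) \<le> 0" .
  have nn: "0 \<le> h i * (1 - (\<epsilon> i *\<^sub>R u i) \<bullet> v)" if "i \<in> I" for i
    using h_pos[OF that] le1[OF that] by simp
  have par: "\<epsilon> i *\<^sub>R u i = v" if i: "i \<in> I" for i
  proof -
    have "(\<Sum>i\<in>I. h i * (1 - (\<epsilon> i *\<^sub>R u i) \<bullet> v)) = 0"
      by (rule order_antisym[OF s0 sum_nonneg[OF nn]])
    from sum_nonneg_0[OF finite_I nn this i] have "h i * (1 - (\<epsilon> i *\<^sub>R u i) \<bullet> v) = 0" by blast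
    then have 1: "(\<epsilon> i *\<^sub>R u i) \<bullet> v = 1" using h_pos[OF i] by simp
    have "(norm (\<epsilon> i *\<^sub>R u i - v))\<^sup>2 = (norm (\<epsilon> i *\<^sub>R u i))\<^sup>2 - 2 * ((\<epsilon> i *\<^sub>R u i) \<bullet> v) + (norm v)\<^sup>2"
      by (rule power2_norm_diff)
    also have "\<dots> = 0" using n1[OF i] v 1 by simp
    finally show ?thesis by simp
  qed
  show ?thesis
  proof (intro exI[of _ v] conjI v ballI)
    fix i assume i: "i \<in> I"
    show "u i = v \<or> u i = - v" using signs_cases[OF \<epsilon> i]
    proof
      assume "\<epsilon> i = 1" then show ?thesis using par[OF i] by simp
    next
      assume "\<epsilon> i = - 1" then show ?thesis using par[OF i] by auto
    qed
  qed
qed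

end

lemma open_subset_Diff_empty:
  fixes S T :: "'a::euclidean_space set"
  assumes "S \<in> lmeasurable" "T \<in> lmeasurable" "S \<subseteq> T" "measure lebesgue T \<le> measure lebesgue S"
    and "open U" "U \<subseteq> T - S"
  shows "U = {}"
proof (rule ccontr)
  assume ne: "U \<noteq> {}"
  have "U \<inter> T = U" using assms(6) by blast
  then have U: "U \<in> lmeasurable" using lmeasurable_Int_open[OF assms(2,5)] by (simp add: Int_commute)
  have "\<not> negligible U" using assms(5) ne open_not_negligible by blast
  then have pos: "0 < measure lebesgue U"
    using negligible_iff_measure0[OF U] zero_less_measure_iff by blast
  have "S \<inter> U = {}" using assms(6) by blast
  then have "measure lebesgue S + measure lebesgue U = measure lebesgue (S \<union> U)"
    by (rule measure_Un_disjoint[OF assms(1) U, symmetric])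
  also have "\<dots> \<le> measure lebesgue T"
    using assms(3,6) by (intro measure_mono_fmeasurable fmeasurableD[OF fmeasurable.Un[OF assms(1) U]] assms(2)) blast
  finally show False using pos assms(4) by simp
qed

text \<open>A point of the convex body outside the compact subset would be near interior points, and thus
  give an open set of positive volume in the difference.\<close>
lemma convex_subset_if_measure_le:
  fixes S T :: "'a::euclidean_space set"
  assumes "compact S" "compact T" "convex T" "interior T \<noteq> {}" "S \<subseteq> T"
    and "measure lebesgue T \<le> measure lebesgue S"
  shows "T \<subseteq> S"
proof (rule ccontr)
  assume "\<not> T \<subseteq> S"
  then obtain p where p: "p \<in> T" "p \<in> - S" by blast
  have "open (- S)" using assms(1) by (simp add: compact_imp_closed open_Compl)
  moreover have "p \<in> closure (interior T)"
    using convex_closure_interior[OF assms(3,4)] p(1) closure_subset by blast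
  ultimately have "- S \<inter> interior T \<noteq> {}"
    using p(2) open_Int_closure_eq_empty by blast
  moreover have "- S \<inter> interior T = {}"
    by (rule open_subset_Diff_empty[OF _ _ assms(5,6)])
      (use assms(1,2) \<open>open (- S)\<close> interior_subset in \<open>auto intro: lmeasurable_compact\<close>)
  ultimately show False by blast
qed

section \<open>Parallel planks\<close>

text \<open>Intervals of total length \<^term>\<open>2 * w\<close> that cover an interval of this length cannot reach
  beyond it.\<close>
lemma interval_cover_excess:
  fixes A B :: "'i \<Rightarrow> real"
  assumes fin: "finite I" and AB: "\<And>i. i \<in> I \<Longrightarrow> A i \<le> B i" and w: "0 < w" and sum: "(\<Sum>i\<in>I. B i - A i) \<le> 2 * w"
    and cover: "{- w<..<w} \<subseteq> (\<Union>i\<in>I. {A i..B i})"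
    and k: "k \<in> I" "A k < t" "t < B k"
  shows "\<bar>t\<bar> \<le> w"
proof (rule ccontr)
  assume t: "\<not> \<bar>t\<bar> \<le> w"
  define \<eta> where "\<eta> = min (\<bar>t\<bar> - w) (min (t - A k) (B k - t))"
  have \<eta>: "0 < \<eta>" "\<eta> \<le> \<bar>t\<bar> - w" "\<eta> \<le> t - A k" "\<eta> \<le> B k - t" using t k by (auto simp: \<eta>_def)
  have m: "{x<..<y} \<in> lmeasurable" for x y :: real
    using lmeasurable_box[of x y] by (simp add: box_real)
  have "{- w<..<w} \<inter> {t - \<eta><..<t + \<eta>} = {}" using \<eta> by (auto simp: abs_if split: if_splits)
  then have "measure lebesgue ({- w<..<w} \<union> {t - \<eta><..<t + \<eta>}) = measure lebesgue {- w<..<w} + measure lebesgue {t - \<eta><..<t + \<eta>}"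
    by (rule measure_Un_disjoint[OF m m])
  also have "\<dots> = 2 * w + 2 * \<eta>" using w \<eta> by simp
  finally have "2 * w + 2 * \<eta> = measure lebesgue ({- w<..<w} \<union> {t - \<eta><..<t + \<eta>})" by simp
  also have "\<dots> \<le> measure lebesgue (\<Union>i\<in>I. {A i..B i})"
  proof (rule measure_mono_fmeasurable)
    have "{t - \<eta><..<t + \<eta>} \<subseteq> {A k..B k}" using \<eta> by auto
    then show "{- w<..<w} \<union> {t - \<eta><..<t + \<eta>} \<subseteq> (\<Union>i\<in>I. {A i..B i})" using cover k(1) by blast
    show "{- w<..<w} \<union> {t - \<eta><..<t + \<eta>} \<in> sets lebesgue" by (intro fmeasurableD fmeasurable.Un m)
    show "(\<Union>i\<in>I. {A i..B i}) \<in> lmeasurable"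
      using fin by (intro fmeasurable.finite_UN lmeasurable_compact compact_Icc)
  qed
  also have "\<dots> \<le> (\<Sum>i\<in>I. measure lebesgue {A i..B i})"
    using fin by (intro measure_UNION_le) auto
  also have "\<dots> = (\<Sum>i\<in>I. B i - A i)" using AB by (intro sum.cong) auto
  finally show False using sum \<eta> by simp
qed

lemma exists_unit_with_inner:
  fixes v :: "'a::euclidean_space"
  assumes d: "2 \<le> DIM('a)" and v: "norm v = 1" and t: "\<bar>t\<bar> \<le> 1"
  obtains y where "norm y = 1" "y \<bullet> v = t"
proof -
  obtain e where e: "e \<noteq> 0" "orthogonal v e" using orthogonal_to_vector_exists[OF d] by blast
  define y where "y = t *\<^sub>R v + (sqrt (1 - t\<^sup>2) / norm e) *\<^sub>R e"
  have vv: "v \<bullet> v = 1" "v \<bullet> e = 0" "e \<bullet> v = 0" using v e by (auto simp: dot_square_norm orthogonal_def inner_commute)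
  have t2: "t\<^sup>2 \<le> 1" using t by (simp add: abs_square_le_1)
  have "(norm y)\<^sup>2 = t\<^sup>2 + (sqrt (1 - t\<^sup>2) / norm e)\<^sup>2 * (norm e)\<^sup>2"
    unfolding power2_norm_eq_inner y_def by (simp add: inner_add_left inner_add_right vv power2_eq_square)
  also have "\<dots> = 1" using e t2 by (simp add: power_divide)
  finally have "norm y = 1" using power2_eq_imp_eq[of "norm y" 1] by simp
  moreover have "y \<bullet> v = t" by (simp add: y_def inner_simps vv)
  ultimately show ?thesis by (rule that)
qed

context plank_system
begin

text \<open>For parallel planks Bang's map moves a point \<^term>\<open>x\<close> along \<^term>\<open>v\<close> by some \<^term>\<open>\<zeta>\<close> of modulus at most
  \<^term>\<open>sum h I\<close>, while the whole segment of half-length \<^term>\<open>sum h I\<close> around \<^term>\<open>x\<close> stays in the ball. The chord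
  of the ball through \<^term>\<open>y\<close> in this direction has length \<^term>\<open>2 * \<bar>y \<bullet> v\<bar>\<close>, which is too short.\<close>
lemma sphere_point_not_in_bang_image:
  assumes v: "norm v = 1" and par: "\<And>i. i \<in> I \<Longrightarrow> u i = v \<or> u i = - v" and ne: "I \<noteq> {}"
    and y: "norm y = 1" "\<bar>y \<bullet> v\<bar> < sum h I"
  shows "y \<notin> bang_image"
proof
  let ?w = "sum h I"
  have w: "0 < ?w" using finite_I ne h_pos by (intro sum_pos) auto
  assume "y \<in> bang_image"
  then obtain \<epsilon> x where \<epsilon>: "\<epsilon> \<in> signs" and x: "x \<in> erosion" and yx: "y = x + vertex \<epsilon>"
    by (auto simp: bang_image_def piece_def add.commute)
  \<comment> \<open>\<^term>\<open>\<sigma> i\<close> records the orientation of \<^term>\<open>u i\<close>; the signs \<^term>\<open>\<sigma>\<close> and \<^term>\<open>- \<sigma> i\<close> give the ends of the segment\<close>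
  define \<sigma> where "\<sigma> i = (if u i = v then 1 else - 1 :: real)" for i
  have \<sigma>: "u i = \<sigma> i *\<^sub>R v" "\<sigma> i * \<sigma> i = 1" if "i \<in> I" for i
    using par[OF that] by (auto simp: \<sigma>_def)
  have vtx: "vertex \<delta> = (\<Sum>i\<in>I. \<delta> i * \<sigma> i * h i) *\<^sub>R v" for \<delta>
    unfolding vertex_def scaleR_sum_left by (intro sum.cong) (auto simp: \<sigma> ac_simps)
  define \<zeta> where "\<zeta> = (\<Sum>i\<in>I. \<epsilon> i * \<sigma> i * h i)"
  have "norm (vertex \<epsilon>) = \<bar>\<zeta>\<bar>" by (simp add: vtx \<zeta>_def v)
  then have \<zeta>: "\<bar>\<zeta>\<bar> \<le> ?w" using norm_vertex_le[OF \<epsilon>] by simp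
  have ext: "norm (x + (c * ?w) *\<^sub>R v) \<le> 1" if c: "c \<in> {-1, 1}" for c
  proof -
    have "restrict (\<lambda>i. c * \<sigma> i) I \<in> signs" using c by (intro restrict_signs) (auto simp: \<sigma>_def)
    then have "norm (x + vertex (restrict (\<lambda>i. c * \<sigma> i) I)) \<le> 1" using x by (simp add: erosion_def)
    also have "vertex (restrict (\<lambda>i. c * \<sigma> i) I) = (c * ?w) *\<^sub>R v"
      unfolding vtx sum_distrib_left by (intro arg_cong2[where f = scaleR] sum.cong) (auto simp: \<sigma> mult.assoc)
    finally show ?thesis .
  qed
  have vv: "v \<bullet> v = 1" using v by (simp add: dot_square_norm)
  have quad: "s * (2 * (y \<bullet> v) + s) \<le> 0" if "norm (y + s *\<^sub>R v) \<le> 1" for s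
  proof -
    have "(norm (y + s *\<^sub>R v))\<^sup>2 \<le> 1" using that by (simp add: power_le_one)
    moreover have "(norm (y + s *\<^sub>R v))\<^sup>2 = (norm y)\<^sup>2 + s * (2 * (y \<bullet> v) + s)"
      unfolding power2_norm_eq_inner by (simp add: inner_add_left inner_add_right vv inner_commute algebra_simps)
    ultimately show ?thesis using y(1) by simp
  qed
  have xy: "x = y - \<zeta> *\<^sub>R v" using yx by (simp add: vtx \<zeta>_def)
  have "norm (y + (?w - \<zeta>) *\<^sub>R v) \<le> 1" "norm (y + (- ?w - \<zeta>) *\<^sub>R v) \<le> 1"
    using ext[of 1] ext[of "-1"] by (simp_all add: xy algebra_simps)
  then have q: "(?w - \<zeta>) * (2 * (y \<bullet> v) + (?w - \<zeta>)) \<le> 0" "(- ?w - \<zeta>) * (2 * (y \<bullet> v) + (- ?w - \<zeta>)) \<le> 0"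
    by (auto dest: quad)
  have 1: "?w = \<zeta> \<or> 2 * (y \<bullet> v) + (?w - \<zeta>) \<le> 0"
    using q(1) \<zeta> by (auto simp: mult_le_0_iff)
  have 2: "- ?w = \<zeta> \<or> 0 \<le> 2 * (y \<bullet> v) + (- ?w - \<zeta>)"
    using q(2) \<zeta> by (auto simp: mult_le_0_iff)
  show False using 1 2 y(2) w \<zeta> by argo
qed

end

section \<open>Optimal families\<close>

lemma measure_Diff_eq:
  assumes "S \<in> fmeasurable M" "S \<inter> T \<in> sets M"
  shows "measure M (S - T) = measure M S - measure M (S \<inter> T)"
proof -
  have m: "S \<inter> T \<in> fmeasurable M" using fmeasurableI2[OF assms(1) _ assms(2)] by simp
  have "S - T = S - S \<inter> T" by blast
  then have "S - T \<in> fmeasurable M" using fmeasurable.Diff[OF assms(1) m] by simp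
  then have "measure M (S \<inter> T \<union> (S - T)) = measure M (S \<inter> T) + measure M (S - T)"
    by (intro measure_Un_disjoint m) auto
  then show ?thesis by (simp add: Int_Diff_Un)
qed

lemma open_strip_eq: "open_strip u a b = {x. a < u \<bullet> x} \<inter> {x. u \<bullet> x < b}"
  by (auto simp: open_strip_def inner_commute)

lemma open_open_strip: "open (open_strip u a b)"
  unfolding open_strip_eq using open_halfspace_gt[of a u] open_halfspace_lt[of u b] by (intro open_Int) auto

lemma closed_strip_subset:
  "closed_strip u a b \<subseteq> open_strip u a b \<union> (hyperplane u a \<union> hyperplane u b)"
  by (auto simp: open_strip_def closed_strip_def hyperplane_def)

lemma negligible_hyperplane_unit: "norm u = 1 \<Longrightarrow> negligible (hyperplane u c)"
  using negligible_hyperplane[of u c] by (cases "u = 0") (auto simp: hyperplane_def inner_commute)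

lemma bchoice_triple:
  assumes "\<And>x. x \<in> S \<Longrightarrow> \<exists>u a b. Q x u a b"
  shows "\<exists>u a b. \<forall>x\<in>S. Q x (u x) (a x) (b x)"
  using assms by metis

lemma plank_family_strips:
  fixes P :: "nat \<Rightarrow> 'a::euclidean_space set"
  assumes "plank_family W n P"
  shows "\<exists>u a b. (\<forall>i\<in>{1..n}. norm (u i) = 1 \<and> a i < b i \<and>
      (P i = closed_strip (u i) (a i) (b i) \<or> P i = open_strip (u i) (a i) (b i))) \<and>
    (\<Sum>i=1..n. b i - a i) = W"
proof -
  define Q where "Q i u a b \<longleftrightarrow> norm u = 1 \<and> a < b \<and> width (P i) = b - a \<and>
      (P i = closed_strip u a b \<or> P i = open_strip u a b)" for i u a b
  have "\<exists>u a b. Q i u a b" if "i \<in> {1..n}" for i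
  proof -
    have "plank (P i)" using assms that unfolding plank_family_def by blast
    then obtain w where w: "plank_of_width w (P i)" unfolding plank_def by blast
    then obtain u a b where "norm u = 1" "a < b" "w = b - a" "P i = closed_strip u a b \<or> P i = open_strip u a b"
      unfolding plank_of_width_def by blast
    then have "Q i u a b" using width_eq[OF w] by (simp add: Q_def)
    then show ?thesis by blast
  qed
  from bchoice_triple[of "{1..n}" Q, OF this] obtain u a b where *: "\<forall>i\<in>{1..n}. Q i (u i) (a i) (b i)"
    by blast
  have **: "norm (u i) = 1" "a i < b i" "width (P i) = b i - a i"
    "P i = closed_strip (u i) (a i) (b i) \<or> P i = open_strip (u i) (a i) (b i)" if "i \<in> {1..n}" for i
    using bspec[OF * that] unfolding Q_def by blast+
  have "(\<Sum>i=1..n. b i - a i) = (\<Sum>i=1..n. width (P i))"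
    by (rule sum.cong[OF refl]) (simp only: **(3))
  then have "(\<Sum>i=1..n. b i - a i) = W" using assms by (simp only: plank_family_def)
  then show ?thesis using ** by blast
qed

lemma Int_sym_diff_subset:
  "S \<subseteq> T \<Longrightarrow> T \<subseteq> S \<union> H \<Longrightarrow> B \<inter> S - B \<inter> T \<union> (B \<inter> T - B \<inter> S) \<subseteq> H"
  by blast

text \<open>The optimal family is compared with a single central plank of the same total width and of
  arbitrary direction.\<close>
lemma uncovered_le_lens:
  fixes P :: "nat \<Rightarrow> 'a::euclidean_space set" and v :: 'a
  assumes W: "0 < W" and opt: "optimal_plank_family W n P"
    and u: "\<And>i. i \<in> {1..n} \<Longrightarrow> norm (u i) = 1" and ab: "\<And>i. i \<in> {1..n} \<Longrightarrow> a i < b i"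
    and P: "\<And>i. i \<in> {1..n} \<Longrightarrow> P i = closed_strip (u i) (a i) (b i) \<or> P i = open_strip (u i) (a i) (b i)"
    and v: "norm v = 1"
  shows "measure lebesgue (cball 0 1 - (\<Union>i\<in>{1..n}. open_strip (u i) (a i) (b i)))
    \<le> measure lebesgue (lens (W / 2) v)"
proof -
  let ?B = "cball (0::'a) 1" and ?O = "\<Union>i\<in>{1..n}. open_strip (u i) (a i) (b i)"
  let ?C = "closed_strip v (- (W / 2)) (W / 2)"
  have O: "?B \<inter> ?O \<in> lmeasurable"
    by (intro lmeasurable_Int_open lmeasurable_cball open_UN ballI open_open_strip)
  have C: "?B \<inter> ?C \<in> lmeasurable"
    by (intro lmeasurable_compact compact_Int_closed compact_cball closed_closed_strip)
  have "plank_of_width W ?C"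
    unfolding plank_of_width_def using v W by (intro exI[of _ v] exI[of _ "- (W / 2)"] exI[of _ "W / 2"]) auto
  then have "plank_family W 1 (\<lambda>_. ?C)"
    using width_eq[of W ?C] unfolding plank_family_def plank_def by (simp, blast)
  then have "covered_volume 1 (\<lambda>_. ?C) \<le> covered_volume n P"
    using opt unfolding optimal_plank_family_def by blast
  then have le: "measure lebesgue (?B \<inter> ?C) \<le> measure lebesgue (?B \<inter> (\<Union>i\<in>{1..n}. P i))"
    by (simp add: covered_volume_def)
  have "measure lebesgue (?B \<inter> (\<Union>i\<in>{1..n}. P i)) = measure lebesgue (?B \<inter> ?O)"
  proof (rule measure_negligible_symdiff[OF O])
    have 1: "open_strip (u i) (a i) (b i) \<subseteq> P i" if "i \<in> {1..n}" for i
      using P[OF that] open_strip_subset[of "u i" "a i" "b i"] by auto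
    have 2: "P i \<subseteq> open_strip (u i) (a i) (b i) \<union> (hyperplane (u i) (a i) \<union> hyperplane (u i) (b i))"
      if "i \<in> {1..n}" for i
      using P[OF that] closed_strip_subset[of "u i" "a i" "b i"] by auto
    have "?O \<subseteq> (\<Union>i\<in>{1..n}. P i)" by (rule UN_mono[OF order_refl 1])
    moreover have "(\<Union>i\<in>{1..n}. P i)
        \<subseteq> (\<Union>i\<in>{1..n}. open_strip (u i) (a i) (b i) \<union> (hyperplane (u i) (a i) \<union> hyperplane (u i) (b i)))"
      by (rule UN_mono[OF order_refl 2])
    ultimately have "?B \<inter> ?O - ?B \<inter> (\<Union>i\<in>{1..n}. P i) \<union> (?B \<inter> (\<Union>i\<in>{1..n}. P i) - ?B \<inter> ?O)
        \<subseteq> (\<Union>i\<in>{1..n}. hyperplane (u i) (a i) \<union> hyperplane (u i) (b i))"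
      by (intro Int_sym_diff_subset) (simp_all only: UN_Un_distrib)
    moreover have "negligible (\<Union>i\<in>{1..n}. hyperplane (u i) (a i) \<union> hyperplane (u i) (b i))"
    proof (rule negligible_Union)
      fix T assume "T \<in> (\<lambda>i. hyperplane (u i) (a i) \<union> hyperplane (u i) (b i)) ` {1..n}"
      then obtain i where "i \<in> {1..n}" "T = hyperplane (u i) (a i) \<union> hyperplane (u i) (b i)" by blast
      then show "negligible T" using negligible_hyperplane_unit[OF u] by (simp only: negligible_Un)
    qed (rule finite_imageI[OF finite_atLeastAtMost])
    ultimately show "negligible (?B \<inter> ?O - ?B \<inter> (\<Union>i\<in>{1..n}. P i) \<union> (?B \<inter> (\<Union>i\<in>{1..n}. P i) - ?B \<inter> ?O))"
      by (rule negligible_subset[rotated])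
  qed
  then have "measure lebesgue (?B \<inter> ?C) \<le> measure lebesgue (?B \<inter> ?O)" using le by (simp only:)
  then have "measure lebesgue (?B - ?O) \<le> measure lebesgue (?B - ?C)"
    unfolding measure_Diff_eq[OF lmeasurable_cball fmeasurableD[OF O]]
      measure_Diff_eq[OF lmeasurable_cball fmeasurableD[OF C]]
    by (rule diff_left_mono)
  moreover have "measure lebesgue (?B - ?C) \<le> measure lebesgue (lens (W / 2) v)"
    by (rule measure_caps_le_lens[OF v]) (simp add: W)
  ultimately show ?thesis by (rule order_trans)
qed

theorem mainTheorem2:
  fixes P :: "nat \<Rightarrow> 'a::euclidean_space set" and n :: nat and W :: real
  assumes "DIM('a) \<ge> 2"
    and "0 < W" and "W < 2"
    and "optimal_plank_family W n P"
  shows "\<exists>u::'a. norm u = 1 \<and>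
    sym_diff (\<Union>i\<in>{1..n}. P i) {x. \<bar>x \<bullet> u\<bar> \<le> W / 2}
      \<subseteq> (\<Union>i\<in>{1..n}. frontier (P i)) \<union> hyperplane u (W / 2) \<union> hyperplane u (- W / 2)"
proof -
  let ?I = "{1..n}" and ?B = "cball (0::'a) 1"
  define w where "w = W / 2"
  have w: "0 < w" "w < 1" using assms(2,3) by (auto simp: w_def)
  have "plank_family W n P" using assms(4) by (simp add: optimal_plank_family_def)
  from plank_family_strips[OF this] obtain u a b where
      strips: "\<forall>i\<in>?I. norm (u i) = 1 \<and> a i < b i \<and>
        (P i = closed_strip (u i) (a i) (b i) \<or> P i = open_strip (u i) (a i) (b i))"
    and sumW: "(\<Sum>i=1..n. b i - a i) = W"
    by blast
  have u: "norm (u i) = 1" if "i \<in> ?I" for i by (rule conjunct1[OF bspec[OF strips that]])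
  have ab: "a i < b i" if "i \<in> ?I" for i by (rule conjunct1[OF conjunct2[OF bspec[OF strips that]]])
  have P: "P i = closed_strip (u i) (a i) (b i) \<or> P i = open_strip (u i) (a i) (b i)" if "i \<in> ?I" for i
    by (rule conjunct2[OF conjunct2[OF bspec[OF strips that]]])
  define h m where "h i = (b i - a i) / 2" and "m i = (a i + b i) / 2" for i
  have mh: "m i - h i = a i" "m i + h i = b i" for i by (simp_all add: h_def m_def field_simps)
  interpret plank_system ?I u h m
  proof
    show "finite ?I" by simp
    show "norm (u i) = 1" if "i \<in> ?I" for i by (rule u[OF that])
    show "0 < h i" if "i \<in> ?I" for i using ab[OF that] by (simp add: h_def)
  qed
  have sumh: "sum h ?I = w" unfolding h_def w_def sum_divide_distrib[symmetric] sumW ..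
  have ne: "?I \<noteq> {}"
  proof
    assume "?I = {}"
    then have "sum h ?I = 0" by (simp only: sum.empty)
    then show False using sumh w(1) by linarith
  qed
  let ?O = "\<Union>i\<in>?I. open_strip (u i) (a i) (b i)"
  have D: "?B - ?O \<in> lmeasurable"
    by (intro lmeasurable_compact compact_diff compact_cball open_UN ballI open_open_strip)
  have sub: "bang_image \<subseteq> ?B - ?O" using bang_image_subset unfolding mh .
  have le_lens: "measure lebesgue (?B - ?O) \<le> measure lebesgue (lens (sum h ?I) v)" if "norm v = 1" for v :: 'a
    unfolding sumh w_def by (rule uncovered_le_lens[OF assms(2,4) u ab P that])
  have bD: "measure lebesgue bang_image \<le> measure lebesgue (?B - ?O)"
    by (rule measure_mono_fmeasurable[OF sub fmeasurableD[OF lmeasurable_compact[OF compact_bang_image]] D])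
  have s: "measure lebesgue (?B - ?O) \<le> measure lebesgue (lens (sum h ?I) (u i))" if "i \<in> ?I" for i
    by (rule le_lens[OF u[OF that]])
  have DM: "measure lebesgue (?B - ?O) \<le> measure lebesgue lens_mean"
    and cM: "compact lens_mean"
    using lens_mean_properties[OF ne s] by simp_all
  have Mb: "measure lebesgue lens_mean \<le> measure lebesgue erosion"
    by (rule measure_mono_fmeasurable[OF lens_mean_subset[OF ne]
          fmeasurableD[OF lmeasurable_compact[OF cM]] lmeasurable_compact[OF compact_erosion]])
  \<comment> \<open>the chain of inequalities closes up, so the erosion is no larger than the mean of the lenses\<close>
  have eMle: "measure lebesgue erosion \<le> measure lebesgue lens_mean"
    by (rule order_trans[OF measure_erosion_le order_trans[OF bD DM]])
  have lt1: "sum h ?I < 1" using sumh w(2) by simp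
  have "interior erosion \<noteq> {}" using zero_in_interior_erosion[OF lt1] by blast
  then have eM: "erosion \<subseteq> lens_mean"
    by (rule convex_subset_if_measure_le[OF cM compact_erosion convex_erosion _ lens_mean_subset[OF ne] eMle])
  from parallel_if_erosion_eq[OF ne lt1 eM assms(1)]
  obtain v where v: "norm v = 1" and "\<forall>i\<in>?I. u i = v \<or> u i = - v" by blast
  then have par: "u i = v \<or> u i = - v" if "i \<in> ?I" for i using that by blast
  have full: "measure lebesgue (?B - ?O) \<le> measure lebesgue bang_image"
    by (rule order_trans[OF DM order_trans[OF Mb measure_erosion_le]])
  \<comment> \<open>the planks as conditions on \<^term>\<open>x \<bullet> v\<close>; reversing a normal reverses its interval\<close>
  define A B where "A i = (if u i = v then a i else - b i)" and "B i = (if u i = v then b i else - a i)" for i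
  have cs: "closed_strip (u i) (a i) (b i) = {x. A i \<le> x \<bullet> v \<and> x \<bullet> v \<le> B i}"
    and os: "open_strip (u i) (a i) (b i) = {x. A i < x \<bullet> v \<and> x \<bullet> v < B i}" if "i \<in> ?I" for i
    using par[OF that] by (cases "u i = v"; force simp: A_def B_def closed_strip_def open_strip_def)+
  have AB: "A i < B i" "B i - A i = b i - a i" if "i \<in> ?I" for i using ab[OF that] by (auto simp: A_def B_def)
  have cover: "{- w<..<w} \<subseteq> (\<Union>i\<in>?I. {A i..B i})"
  proof
    fix t assume t: "t \<in> {- w<..<w}"
    have tw: "\<bar>t\<bar> < w" using t unfolding greaterThanLessThan_iff by linarith
    then have "\<bar>t\<bar> \<le> 1" using w(2) by linarith
    then obtain y where y: "norm y = 1" "y \<bullet> v = t"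
      by (rule exists_unit_with_inner[OF assms(1) v])
    show "t \<in> (\<Union>i\<in>?I. {A i..B i})"
    proof (rule ccontr)
      assume nt: "t \<notin> (\<Union>i\<in>?I. {A i..B i})"
      define U where "U = - ((\<Union>i\<in>?I. closed_strip (u i) (a i) (b i)) \<union> bang_image)"
      have oU: "open U" unfolding U_def
        by (intro open_Compl closed_Un closed_UN ballI closed_closed_strip compact_imp_closed compact_bang_image) auto
      have "y \<notin> bang_image"
        using sphere_point_not_in_bang_image[OF v par ne y(1)] y(2) tw sumh by simp
      moreover have "y \<notin> closed_strip (u i) (a i) (b i)" if i: "i \<in> ?I" for i
      proof -
        have "t \<notin> {A i..B i}" using nt i by blast
        then show ?thesis unfolding cs[OF i] by (simp add: y(2))
      qed
      ultimately have yU: "y \<in> U" unfolding U_def by blast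
      \<comment> \<open>near \<^term>\<open>y\<close> there is an open part of the ball that is neither covered nor hit by Bang's map\<close>
      have "y \<in> closure (ball 0 1)" using y(1) by simp
      then have "U \<inter> ball 0 1 \<noteq> {}" using oU yU open_Int_closure_eq_empty by blast
      moreover have "U \<inter> ball 0 1 = {}"
      proof (rule open_subset_Diff_empty[OF lmeasurable_compact[OF compact_bang_image] D sub full])
        show "open (U \<inter> ball 0 1)" using oU by auto
        show "U \<inter> ball 0 1 \<subseteq> ?B - ?O - bang_image"
        proof
          fix x assume x: "x \<in> U \<inter> ball 0 1"
          have "?O \<subseteq> (\<Union>i\<in>?I. closed_strip (u i) (a i) (b i))"
            by (rule UN_mono[OF order_refl open_strip_subset])
          then have "x \<notin> ?O" "x \<notin> bang_image" using x unfolding U_def by blast+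
          moreover have "x \<in> ?B" using x by simp
          ultimately show "x \<in> ?B - ?O - bang_image" by blast
        qed
      qed
      ultimately show False by blast
    qed
  qed
  have front: "frontier (P i) = hyperplane (u i) (a i) \<union> hyperplane (u i) (b i)" if "i \<in> ?I" for i
    using P[OF that] frontier_strip[OF u[OF that] ab[OF that]] by auto
  have strip: "open_strip (u i) (a i) (b i) \<subseteq> P i" "P i \<subseteq> closed_strip (u i) (a i) (b i)" if "i \<in> ?I" for i
    using P[OF that] open_strip_subset[of "u i" "a i" "b i"] by auto
  have closed_strip: "closed_strip (u i) (a i) (b i) \<subseteq> open_strip (u i) (a i) (b i) \<union> frontier (P i)"
    if "i \<in> ?I" for i
    unfolding front[OF that] by (rule closed_strip_subset)
  have inner: "x \<in> (\<Union>i\<in>?I. frontier (P i)) \<union> hyperplane v w \<union> hyperplane v (- w)"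
    if x: "x \<notin> (\<Union>i\<in>?I. P i)" "\<bar>x \<bullet> v\<bar> \<le> w" for x
  proof (cases "\<bar>x \<bullet> v\<bar> = w")
    case True
    then have "x \<bullet> v = w \<or> x \<bullet> v = - w" by linarith
    then show ?thesis unfolding hyperplane_def by blast
  next
    case False
    then have "x \<bullet> v \<in> {- w<..<w}" using x(2) by (simp add: abs_if split: if_splits)
    then have "x \<bullet> v \<in> (\<Union>i\<in>?I. {A i..B i})" by (rule subsetD[OF cover])
    then obtain i where i: "i \<in> ?I" "x \<bullet> v \<in> {A i..B i}" by (rule UN_E)
    have "x \<in> closed_strip (u i) (a i) (b i)" unfolding cs[OF i(1)] using i(2) by simp
    then have "x \<in> open_strip (u i) (a i) (b i) \<union> frontier (P i)" by (rule subsetD[OF closed_strip[OF i(1)]])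
    moreover have "x \<notin> P i" using x(1) i(1) by blast
    then have "x \<notin> open_strip (u i) (a i) (b i)" using subsetD[OF strip(1)[OF i(1)]] by blast
    ultimately have "x \<in> frontier (P i)" by blast
    then show ?thesis using i(1) by blast
  qed
  have outer: "x \<in> frontier (P i)" if i: "i \<in> ?I" and x: "x \<in> P i" "\<not> \<bar>x \<bullet> v\<bar> \<le> w" for x i
  proof (rule ccontr)
    assume "x \<notin> frontier (P i)"
    moreover have "x \<in> open_strip (u i) (a i) (b i) \<union> frontier (P i)"
      by (rule subsetD[OF closed_strip[OF i] subsetD[OF strip(2)[OF i] x(1)]])
    ultimately have "x \<in> {x. A i < x \<bullet> v \<and> x \<bullet> v < B i}" unfolding os[OF i] by blast
    then have "A i < x \<bullet> v" "x \<bullet> v < B i" by simp_all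
    moreover have "(\<Sum>i\<in>?I. B i - A i) = (\<Sum>i\<in>?I. b i - a i)" by (rule sum.cong[OF refl AB(2)])
    then have "(\<Sum>i\<in>?I. B i - A i) \<le> 2 * w" using sumW by (simp add: w_def)
    ultimately have "\<bar>x \<bullet> v\<bar> \<le> w"
      using interval_cover_excess[OF finite_atLeastAtMost less_imp_le[OF AB(1)] w(1) _ cover i] by blast
    then show False using x(2) by simp
  qed
  show ?thesis
  proof (intro exI[of _ v] conjI v subsetI)
    fix x assume x: "x \<in> sym_diff (\<Union>i\<in>?I. P i) {x. \<bar>x \<bullet> v\<bar> \<le> W / 2}"
    have "x \<in> (\<Union>i\<in>?I. frontier (P i)) \<union> hyperplane v w \<union> hyperplane v (- w)"
    proof (cases "\<bar>x \<bullet> v\<bar> \<le> w")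
      case True
      then show ?thesis using x inner[OF _ True] by (simp add: w_def)
    next
      case False
      then have "x \<in> (\<Union>i\<in>?I. P i)" using x by (simp add: w_def)
      then obtain i where "i \<in> ?I" "x \<in> P i" by (rule UN_E)
      then show ?thesis using outer[OF _ _ False] by blast
    qed
    then show "x \<in> (\<Union>i\<in>?I. frontier (P i)) \<union> hyperplane v (W / 2) \<union> hyperplane v (- W / 2)"
      by (simp add: w_def)
  qed
qed

end
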